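(* Fix $0<\alpha\le 1$. Let $\mathcal G_{k,\alpha}$ denote the Erdős–Rényi random graph on $k$ vertices with edge probability $\alpha$. Then, with probability tending to $1$ as $k\to\infty$, the limit $\ell(\mathcal G_{k,\alpha})$ exists and $$\ell(\mathcal G_{k,\alpha})=\frac{1}{\lambda(\mathcal G_{k,\alpha})}.$$
   Context: $H$-percolation: fix a graph $H$. Start with $\mathcal G_0=\mathcal G_{n,p}$ (Erdős–Rényi graph on $n$ vertices, edge probability $p$). For $t\ge 1$, obtain $\mathcal G_t$ from $\mathcal G_{t-1}$ by adding every edge $e\notin\mathcal G_{t-1}$ such that $\mathcal G_{t-1}\cup\{e\}$ contains a copy of $H$ containing $e$. Let $\langle \mathcal G_{n,p}\rangle_H=\bigcup_{t\ge0}\mathcal G_t$. The critical threshold is $p_c(n,H)=\inf\{p>0:\ \mathbb P(\langle\mathcal G_{n,p}\rangle_H=K_n)\ge 1/2\}$, and $\ell(H)=-\lim_{n\to\infty}\frac{\log p_c(n,H)}{\log n}$. For a graph $H$ with $v_H$ vertices and $e_H$ edges, $\lambda(H)=\frac{e_H-2}{v_H-2}$. *)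

theory Defs
  imports Complex_Main
begin

text \<open>Graphs on the vertex set {0..<n}, represented by their edge sets
  (sets of 2-element subsets of {0..<n}).\<close>

definition all_edges :: "nat \<Rightarrow> nat set set" where
  "all_edges n = {e. \<exists>u v. u < n \<and> v < n \<and> u \<noteq> v \<and> e = {u, v}}"

definition gnp_prob :: "nat \<Rightarrow> real \<Rightarrow> (nat set set \<Rightarrow> bool) \<Rightarrow> real" where
  "gnp_prob n p P = (\<Sum>G\<in>{G. G \<subseteq> all_edges n \<and> P G}.
      p ^ card G * (1 - p) ^ (card (all_edges n) - card G))"

definition has_copy_containing ::
  "nat \<Rightarrow> nat \<Rightarrow> nat set set \<Rightarrow> nat set set \<Rightarrow> nat set \<Rightarrow> bool" where
  "has_copy_containing n k EH G e \<longleftrightarrow>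
     (\<exists>f. inj_on f {0..<k} \<and> f ` {0..<k} \<subseteq> {0..<n} \<and>
          (\<forall>x\<in>EH. f ` x \<in> G) \<and> e \<in> (\<lambda>x. f ` x) ` EH)"

definition perc_step :: "nat \<Rightarrow> nat \<Rightarrow> nat set set \<Rightarrow> nat set set \<Rightarrow> nat set set" where
  "perc_step n k EH G =
     G \<union> {e \<in> all_edges n. e \<notin> G \<and> has_copy_containing n k EH (G \<union> {e}) e}"

definition perc_closure :: "nat \<Rightarrow> nat \<Rightarrow> nat set set \<Rightarrow> nat set set \<Rightarrow> nat set set" where
  "perc_closure n k EH G = (\<Union>t. (perc_step n k EH ^^ t) G)"

definition p_crit :: "nat \<Rightarrow> nat \<Rightarrow> nat set set \<Rightarrow> real" where
  "p_crit n k EH = Inf {p. 0 < p \<and> p \<le> 1 \<and>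
      gnp_prob n p (\<lambda>G. perc_closure n k EH G = all_edges n) \<ge> 1 / 2}"

definition lambda_H :: "nat \<Rightarrow> nat set set \<Rightarrow> real" where
  "lambda_H k EH = (real (card EH) - 2) / (real k - 2)"

end

theory Submission
  imports Defs "HOL-Probability.Probability" "HOL-Real_Asymp.Real_Asymp"
begin

text \<open>
  Write $\lambda$ for $\lambda(H)$. Call $H$ balanced if $\lambda \ge 1$ and every vertex set $F$ with
  $2 \le |F| < v_H$ spans at most $\lambda (|F| - 2) + 1$ edges. For balanced $H$ the exponent is $1/\lambda$:

  \<^item> Above the threshold, chain copies of $H$ in which consecutive copies share an edge that is absent
    from the initial graph. A chain of $L$ copies hanging on a root edge has $L (v_H - 2)$ new vertices and
    $\lambda L (v_H - 2) + 1$ edges, and infects its root. Balancedness makes all proper rooted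
    subgraphs sparse enough for a second moment argument; repeating it on disjoint
    vertex classes makes the failure probability smaller than any power of $n$.

  \<^item> Below the threshold, cover the graph by edge-disjoint clusters, vertex sets $S$ owning at least
    $\lambda (|S| - 2) + 1$ edges, starting with the single edges. Whenever a copy of $H$ minus an edge is
    spread over several clusters, balancedness implies that their union is again a cluster. Hence an
    infected edge lies in a small cluster, or else some cluster has a size in a bounded window of
    large sizes; both are unlikely by a union bound over sets of bounded size.

  A random graph of density $\alpha$ is balanced with high probability: small sets $F$ satisfy the condition
  trivially, and for the others it follows from lower bounds on degrees and codegrees.
\<close>

section \<open>Random subsets of a finite set\<close>

lemma indep_vars_map_pmf:
  assumes ind: "prob_space.indep_vars (measure_pmf q) M' (\<lambda>i x. X i (f x)) I"
    and X: "\<And>i. i \<in> I \<Longrightarrow> X i \<in> UNIV \<rightarrow> space (M' i)"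
  shows "prob_space.indep_vars (measure_pmf (map_pmf f q)) M' X I"
  unfolding prob_space.indep_vars_def2[OF prob_space_measure_pmf]
proof (intro conjI ballI prob_space.indep_setsI[OF prob_space_measure_pmf])
  show "X i \<in> measure_pmf (map_pmf f q) \<rightarrow>\<^sub>M M' i" if "i \<in> I" for i
    using X[OF that] by simp
next
  fix A J assume J: "J \<noteq> {}" "J \<subseteq> I" "finite J"
    and "\<forall>j\<in>J. A j \<in> {X j -` B \<inter> space (measure_pmf (map_pmf f q)) |B. B \<in> sets (M' j)}"
  then obtain B where B: "\<And>j. j \<in> J \<Longrightarrow> B j \<in> sets (M' j)" "\<And>j. j \<in> J \<Longrightarrow> A j = X j -` B j"
    by simp metis
  have "measure_pmf.prob q (\<Inter>j\<in>J. (\<lambda>x. X j (f x)) -` B j)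
      = (\<Prod>j\<in>J. measure_pmf.prob q ((\<lambda>x. X j (f x)) -` B j))"
    using prob_space.indep_varsD[OF prob_space_measure_pmf ind J(1,3,2) B(1)] by simp
  then show "measure_pmf.prob (map_pmf f q) (\<Inter> (A ` J)) = (\<Prod>j\<in>J. measure_pmf.prob (map_pmf f q) (A j))"
    using B(2) by (simp add: vimage_INT vimage_def Collect_ball_eq cong: INF_cong prod.cong)
qed simp

lemma expectation_of_bool:
  "measure_pmf.expectation q (\<lambda>x. of_bool (P x)) = measure_pmf.prob q {x. P x}"
proof -
  have "(\<lambda>x. of_bool (P x) :: real) = indicator {x. P x}"
    by (auto simp: indicator_def)
  then show ?thesis by simp
qed

lemma measure_pmf_Ex_le_sum:
  assumes "finite I"
  shows "measure_pmf.prob q {x. \<exists>i\<in>I. P i x} \<le> (\<Sum>i\<in>I. measure_pmf.prob q {x. P i x})"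
proof -
  have "{x. \<exists>i\<in>I. P i x} = (\<Union>i\<in>I. {x. P i x})"
    by blast
  then show ?thesis
    using assms measure_pmf.finite_measure_subadditive_finite[of I "\<lambda>i. {x. P i x}" q] by simp
qed

lemma (in prob_space) prob_eq_0_le_second_moment:
  fixes X :: "'a \<Rightarrow> real"
  assumes X: "random_variable borel X" "integrable M (\<lambda>x. (X x)\<^sup>2)" and pos: "0 < expectation X"
  shows "prob {x \<in> space M. X x = 0} \<le> expectation (\<lambda>x. (X x)\<^sup>2) / (expectation X)\<^sup>2 - 1"
proof -
  have "integrable M X"
    by (rule square_integrable_imp_integrable[OF X])
  then have var: "variance X = expectation (\<lambda>x. (X x)\<^sup>2) - (expectation X)\<^sup>2"
    using X(2) by (rule variance_eq)
  have "prob {x \<in> space M. X x = 0} \<le> prob {x \<in> space M. expectation X \<le> \<bar>X x - expectation X\<bar>}"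
    using X(1) by (intro finite_measure_mono) auto
  also have "\<dots> \<le> variance X / (expectation X)\<^sup>2"
    by (rule Chebyshev_inequality[OF X pos])
  finally show ?thesis
    unfolding var using pos by (simp add: diff_divide_distrib)
qed

definition random_subset :: "real \<Rightarrow> 'a set \<Rightarrow> 'a set pmf" where
  "random_subset p E = map_pmf (\<lambda>f. {x \<in> E. f x}) (Pi_pmf E False (\<lambda>_. bernoulli_pmf p))"

lemma set_random_subset: "set_pmf (random_subset p E) \<subseteq> Pow E"
  unfolding random_subset_def by auto

lemma finite_set_random_subset: "finite E \<Longrightarrow> finite (set_pmf (random_subset p E))"
  by (rule finite_subset[OF set_random_subset]) simp

lemma pmf_random_subset:
  assumes "finite E" "G \<subseteq> E" "0 \<le> p" "p \<le> 1"
  shows "pmf (random_subset p E) G = p ^ card G * (1 - p) ^ (card E - card G)"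
proof -
  let ?q = "Pi_pmf E False (\<lambda>_. bernoulli_pmf p)"
  have "(\<lambda>f. {x \<in> E. f x}) -` {G} \<inter> set_pmf ?q = {\<lambda>x. x \<in> G} \<inter> set_pmf ?q"
    using assms(1,2) set_Pi_pmf_subset[OF assms(1), of False "\<lambda>_. bernoulli_pmf p"] by fastforce
  from arg_cong[OF this, of "measure_pmf.prob ?q"]
  have "measure_pmf.prob ?q ((\<lambda>f. {x \<in> E. f x}) -` {G}) = measure_pmf.prob ?q {\<lambda>x. x \<in> G}"
    unfolding measure_Int_set_pmf .
  then have "pmf (random_subset p E) G = pmf ?q (\<lambda>x. x \<in> G)"
    unfolding random_subset_def pmf_map measure_pmf_single .
  also have "\<dots> = (\<Prod>x\<in>E. if x \<in> G then p else 1 - p)"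
    using assms by (subst pmf_Pi') (auto intro!: prod.cong)
  also have "\<dots> = p ^ card G * (1 - p) ^ (card E - card G)"
    using assms
    by (simp add: prod.If_cases Int_absorb1 Diff_eq[symmetric] card_Diff_subset finite_subset)
  finally show ?thesis .
qed

lemma prob_random_subset_supset:
  assumes "finite E" "A \<subseteq> E" "0 \<le> p" "p \<le> 1"
  shows "measure_pmf.prob (random_subset p E) {G. A \<subseteq> G} = p ^ card A"
proof -
  have "measure_pmf.prob (random_subset p E) {G. A \<subseteq> G}
      = measure_pmf.prob (Pi_pmf E False (\<lambda>_. bernoulli_pmf p))
          (Pi E (\<lambda>x. if x \<in> A then {True} else UNIV))"
    unfolding random_subset_def measure_map_pmf
    using assms(2) by (intro arg_cong2[where f = measure] refl) (auto simp: Pi_iff split: if_splits)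
  also have "\<dots> = (\<Prod>x\<in>E. if x \<in> A then p else 1)"
    using assms by (subst measure_Pi_pmf_Pi) (auto intro!: prod.cong simp: measure_pmf_single)
  also have "\<dots> = p ^ card A"
    using assms by (simp add: prod.If_cases Int_absorb1)
  finally show ?thesis .
qed

lemma indep_vars_random_subset_Int:
  assumes E: "finite E" and B: "\<And>i. i \<in> I \<Longrightarrow> B i \<subseteq> E" "disjoint_family_on B I"
  shows "prob_space.indep_vars (measure_pmf (random_subset p E)) (\<lambda>_. count_space UNIV)
    (\<lambda>i G. G \<inter> B i) I"
  unfolding random_subset_def
proof (rule indep_vars_map_pmf)
  let ?q = "Pi_pmf E False (\<lambda>_. bernoulli_pmf p)"
  have "prob_space.indep_vars (measure_pmf ?q) (\<lambda>i. PiM (B i) (\<lambda>_. count_space UNIV))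
      (\<lambda>i f. restrict f (B i)) I"
    by (rule prob_space.indep_vars_restrict[OF prob_space_measure_pmf indep_vars_Pi_pmf[OF E] B])
  moreover have "(\<lambda>g. {x \<in> B i. g x}) \<in> PiM (B i) (\<lambda>_. count_space (UNIV :: bool set))
      \<rightarrow>\<^sub>M count_space UNIV"
    if "i \<in> I" for i
    using finite_subset[OF B(1)[OF that] E] by (subst count_space_PiM_finite) auto
  ultimately have "prob_space.indep_vars (measure_pmf ?q) (\<lambda>_. count_space UNIV)
      (\<lambda>i f. {x \<in> B i. restrict f (B i) x}) I"
    by (rule prob_space.indep_vars_compose2[OF prob_space_measure_pmf])
  then show "prob_space.indep_vars (measure_pmf ?q) (\<lambda>_. count_space UNIV)
      (\<lambda>i f. {x \<in> E. f x} \<inter> B i) I"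
    by (rule iffD1[OF prob_space.indep_vars_cong[OF prob_space_measure_pmf], rotated -1])
      (use B(1) in auto)
qed simp

lemma prob_random_subset_disjoint_blocks:
  assumes E: "finite E" and B: "\<And>i. i \<in> I \<Longrightarrow> B i \<subseteq> E" "disjoint_family_on B I" and I: "finite I"
  shows "measure_pmf.prob (random_subset p E) {G. \<forall>i\<in>I. P i (G \<inter> B i)}
    = (\<Prod>i\<in>I. measure_pmf.prob (random_subset p E) {G. P i (G \<inter> B i)})"
proof (cases "I = {}")
  case False
  let ?q = "random_subset p E"
  note indep = indep_vars_random_subset_Int[OF E B]
  have "measure_pmf.prob ?q (\<Inter>i\<in>I. (\<lambda>G. G \<inter> B i) -` Collect (P i) \<inter> space ?q)
      = (\<Prod>i\<in>I. measure_pmf.prob ?q ((\<lambda>G. G \<inter> B i) -` Collect (P i) \<inter> space ?q))"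
    using False I by (intro prob_space.indep_varsD_finite[OF prob_space_measure_pmf indep]) auto
  then show ?thesis
    by (simp add: vimage_def Collect_ball_eq[symmetric])
qed simp

lemma prob_random_subset_card_deviation_le:
  assumes E: "finite E" and B: "\<And>i. i \<in> I \<Longrightarrow> B i \<subseteq> E" "disjoint_family_on B I"
    and b: "\<And>i. i \<in> I \<Longrightarrow> card (B i) = b" and I: "finite I" and p: "0 \<le> p" "p \<le> 1" and \<eta>: "0 \<le> \<eta>"
  shows "measure_pmf.prob (random_subset p E)
      {G. \<eta> * real (card I) \<le> \<bar>real (card {i \<in> I. B i \<subseteq> G}) - p ^ b * real (card I)\<bar>}
    \<le> 2 * exp (- 2 * \<eta>\<^sup>2 * real (card I))"
proof (cases "I = {}")
  case True
  show ?thesis unfolding True by simp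
next
  case False
  let ?q = "measure_pmf (random_subset p E)" and ?X = "\<lambda>i G. of_bool (B i \<subseteq> G) :: real"
  have "prob_space.indep_vars ?q (\<lambda>_. borel) (\<lambda>i G. of_bool (B i \<subseteq> G \<inter> B i) :: real) I"
    using indep_vars_random_subset_Int[OF E B]
    by (rule prob_space.indep_vars_compose2[OF prob_space_measure_pmf]) simp_all
  then have indep: "prob_space.indep_vars ?q (\<lambda>_. borel) ?X I"
    by simp
  have exp: "measure_pmf.expectation (random_subset p E) (?X i) = p ^ b" if "i \<in> I" for i
    using prob_random_subset_supset[OF E B(1)[OF that] p] b[OF that] by (simp only: expectation_of_bool)
  interpret Hoeffding_ineq ?q I ?X "\<lambda>_. 0" "\<lambda>_. 1" "real (card I) * p ^ b"
    by unfold_locales (use indep I exp in auto)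
  have sum: "(\<Sum>i\<in>I. ?X i G) = real (card {i \<in> I. B i \<subseteq> G})" for G
    using I by (simp add: sum.If_cases of_bool_def Int_def)
  have "- 2 * (\<eta> * real (card I))\<^sup>2 / real (card I) = - 2 * \<eta>\<^sup>2 * real (card I)"
    using False I by (simp add: power2_eq_square)
  then show ?thesis
    using Hoeffding_ineq_abs_ge[of "\<eta> * real (card I)"] \<eta> False I
    by (simp add: sum card_gt_0_iff mult.commute)
qed

lemma prob_random_subset_two_supsets:
  assumes E: "finite E" and AB: "A \<subseteq> E" "B \<subseteq> E" "card A = m" "card B = m" and p: "0 < p" "p \<le> 1"
  shows "measure_pmf.prob (random_subset p E) {G. A \<subseteq> G \<and> B \<subseteq> G} = p ^ (2 * m) * (1 / p) ^ card (A \<inter> B)"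
proof -
  have "2 * m = card (A \<union> B) + card (A \<inter> B)"
    using card_Un_Int[of A B] AB finite_subset[OF _ E] by simp
  then have "p ^ (2 * m) * (1 / p) ^ card (A \<inter> B) = p ^ card (A \<union> B)"
    using p by (simp add: power_add power_divide)
  then show ?thesis
    using prob_random_subset_supset[OF E, of "A \<union> B" p] AB p by simp
qed

lemma prob_no_subset_le_second_moment:
  fixes T :: "'i \<Rightarrow> 'a set"
  assumes E: "finite E" and I: "finite I" "I \<noteq> {}" and p: "0 < p" "p \<le> 1"
    and T: "\<And>i. i \<in> I \<Longrightarrow> T i \<subseteq> E" "\<And>i. i \<in> I \<Longrightarrow> card (T i) = m"
  shows "measure_pmf.prob (random_subset p E) {G. \<forall>i\<in>I. \<not> T i \<subseteq> G}
    \<le> (\<Sum>i\<in>I. \<Sum>j\<in>I. (1 / p) ^ card (T i \<inter> T j)) / real (card I) ^ 2 - 1"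
proof -
  let ?q = "random_subset p E"
  define X :: "'a set \<Rightarrow> real" where "X G = (\<Sum>i\<in>I. of_bool (T i \<subseteq> G))" for G
  have int: "integrable (measure_pmf ?q) f" for f :: "'a set \<Rightarrow> real"
    using finite_set_random_subset[OF E] by (rule integrable_measure_pmf_finite)
  have EX: "measure_pmf.expectation ?q X = real (card I) * p ^ m"
    unfolding X_def using E T p by (simp add: int expectation_of_bool prob_random_subset_supset)
  have "measure_pmf.expectation ?q (\<lambda>G. (X G)\<^sup>2)
      = (\<Sum>i\<in>I. \<Sum>j\<in>I. measure_pmf.prob ?q {G. T i \<subseteq> G \<and> T j \<subseteq> G})"
    unfolding X_def power2_eq_square sum_product of_bool_conj[symmetric]
    by (simp add: int expectation_of_bool)
  also have "\<dots> = p ^ (2 * m) * (\<Sum>i\<in>I. \<Sum>j\<in>I. (1 / p) ^ card (T i \<inter> T j))"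
    using E T p by (simp add: prob_random_subset_two_supsets sum_distrib_left)
  finally have EX2: "measure_pmf.expectation ?q (\<lambda>G. (X G)\<^sup>2)
      = p ^ (2 * m) * (\<Sum>i\<in>I. \<Sum>j\<in>I. (1 / p) ^ card (T i \<inter> T j))" .
  have "measure_pmf.prob ?q {G. \<forall>i\<in>I. \<not> T i \<subseteq> G} = measure_pmf.prob ?q {G. X G = 0}"
    unfolding X_def using I by (simp add: sum_nonneg_eq_0_iff disjoint_iff Ball_def)
  also have "\<dots> \<le> measure_pmf.expectation ?q (\<lambda>G. (X G)\<^sup>2) / (measure_pmf.expectation ?q X)\<^sup>2 - 1"
    using measure_pmf.prob_eq_0_le_second_moment[of X ?q] int EX I p by (simp add: card_gt_0_iff)
  also have "\<dots> = (\<Sum>i\<in>I. \<Sum>j\<in>I. (1 / p) ^ card (T i \<inter> T j)) / (real (card I))\<^sup>2 - 1"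
    unfolding EX EX2 using p by (simp add: power_mult_distrib power_mult power_even_eq mult.commute)
  finally show ?thesis .
qed

section \<open>Partite embeddings of a rooted template\<close>

definition edges_in :: "'a set set \<Rightarrow> 'a set \<Rightarrow> 'a set set" where
  "edges_in T A = {t \<in> T. t \<subseteq> A}"

lemma edges_in_mono: "T \<subseteq> T' \<Longrightarrow> A \<subseteq> A' \<Longrightarrow> edges_in T A \<subseteq> edges_in T' A'"
  unfolding edges_in_def by blast

lemma finite_edges_in: "finite T \<Longrightarrow> finite (edges_in T A)"
  unfolding edges_in_def by simp

text \<open>When every vertex outside $R$ can be placed in $w$ ways, the summand of $A$ bounds the
  contribution, relative to the squared first moment, of the pairs of embeddings that agree exactly
  on $A$.\<close>

definition overlap_sum :: "'a set \<Rightarrow> 'a set set \<Rightarrow> 'a set \<Rightarrow> real \<Rightarrow> real \<Rightarrow> real" where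
  "overlap_sum V T R w p =
    (\<Sum>A | R \<subset> A \<and> A \<subseteq> V. (1 / w) ^ card (A - R) * (1 / p) ^ card (edges_in T A))"

lemma PiE_disjoint_eqD:
  assumes "disjoint_family_on C V" "\<phi> \<in> Pi\<^sub>E V C" "\<psi> \<in> Pi\<^sub>E V C" "x \<in> V" "y \<in> V" "\<phi> x = \<psi> y"
  shows "x = y"
proof -
  have "\<phi> x \<in> C x" "\<phi> x \<in> C y"
    using PiE_mem[OF assms(2,4)] PiE_mem[OF assms(3,5)] assms(6) by simp_all
  then show ?thesis
    using assms(1,4,5) unfolding disjoint_family_on_def by auto
qed

lemma PiE_disjoint_inj_on:
  assumes "disjoint_family_on C V" "\<phi> \<in> Pi\<^sub>E V C"
  shows "inj_on \<phi> V"
  using PiE_disjoint_eqD[OF assms assms(2)] by (rule inj_onI)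

lemma PiE_disjoint_image_eqD:
  assumes C: "disjoint_family_on C V" and \<phi>: "\<phi> \<in> Pi\<^sub>E V C" and \<psi>: "\<psi> \<in> Pi\<^sub>E V C"
    and t: "t \<subseteq> V" "t' \<subseteq> V" and eq: "\<phi> ` t = \<psi> ` t'"
  shows "t = t'" "t \<subseteq> {x \<in> V. \<phi> x = \<psi> x}"
proof -
  have "x \<in> t' \<and> \<phi> x = \<psi> x" if "x \<in> t" for x
  proof -
    have "\<phi> x \<in> \<psi> ` t'"
      using that eq by blast
    then obtain y where "y \<in> t'" "\<phi> x = \<psi> y"
      by blast
    then show ?thesis
      using PiE_disjoint_eqD[OF C \<phi> \<psi>, of x y] that t by blast
  qed
  moreover have "x \<in> t" if "x \<in> t'" for x
  proof -
    have "\<psi> x \<in> \<phi> ` t"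
      using that eq by blast
    then obtain y where "y \<in> t" "\<psi> x = \<phi> y"
      by blast
    then show ?thesis
      using PiE_disjoint_eqD[OF C \<psi> \<phi>, of x y] that t by blast
  qed
  ultimately show "t = t'" "t \<subseteq> {x \<in> V. \<phi> x = \<psi> x}"
    using t by blast+
qed

lemma card_image_copies_Int_le:
  assumes C: "disjoint_family_on C V" and \<phi>: "\<phi> \<in> Pi\<^sub>E V C" and \<psi>: "\<psi> \<in> Pi\<^sub>E V C"
    and T: "finite T" "T \<subseteq> Pow V"
  shows "card ((`) \<phi> ` T \<inter> (`) \<psi> ` T) \<le> card (edges_in T {x \<in> V. \<phi> x = \<psi> x})"
proof (rule surj_card_le)
  show "finite (edges_in T {x \<in> V. \<phi> x = \<psi> x})"
    using T(1) by (rule finite_edges_in)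
  show "(`) \<phi> ` T \<inter> (`) \<psi> ` T \<subseteq> (`) \<phi> ` edges_in T {x \<in> V. \<phi> x = \<psi> x}"
  proof
    fix e assume "e \<in> (`) \<phi> ` T \<inter> (`) \<psi> ` T"
    then obtain t t' where t: "t \<in> T" "t' \<in> T" "e = \<phi> ` t" "\<phi> ` t = \<psi> ` t'"
      by auto
    then have "t \<subseteq> {x \<in> V. \<phi> x = \<psi> x}"
      using T(2) by (intro PiE_disjoint_image_eqD(2)[OF C \<phi> \<psi>, of t t']) auto
    then show "e \<in> (`) \<phi> ` edges_in T {x \<in> V. \<phi> x = \<psi> x}"
      using t unfolding edges_in_def by blast
  qed
qed

lemma card_PiE_agreeing_le:
  assumes V: "finite V" and \<phi>: "\<phi> \<in> Pi\<^sub>E V C" and A: "R \<subseteq> A" "A \<subseteq> V"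
    and C: "\<And>x. x \<in> V \<Longrightarrow> finite (C x)" "\<And>x. x \<in> V - R \<Longrightarrow> card (C x) = w"
  shows "card {\<psi> \<in> Pi\<^sub>E V C. {x \<in> V. \<phi> x = \<psi> x} = A} \<le> w ^ card (V - A)"
proof -
  let ?D = "\<lambda>x. if x \<in> A then {\<phi> x} else C x"
  have "card {\<psi> \<in> Pi\<^sub>E V C. {x \<in> V. \<phi> x = \<psi> x} = A} \<le> card (Pi\<^sub>E V ?D)"
    using V C(1) by (intro card_mono finite_PiE) (auto simp: PiE_iff extensional_def)
  also have "\<dots> = (\<Prod>x\<in>V. if x \<in> A then 1 else card (C x))"
    using V by (auto simp: card_PiE intro: prod.cong)
  also have "\<dots> = (\<Prod>x\<in>V - A. card (C x))"
    using V by (simp add: prod.If_cases Diff_eq)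
  also have "\<dots> = (\<Prod>x\<in>V - A. w)"
    using A(1) C(2) by (intro prod.cong) auto
  finally show ?thesis by simp
qed

locale rooted_template =
  fixes V R :: "'v set" and T :: "'v set set" and C :: "'v \<Rightarrow> 'u set" and w :: nat
  assumes finite_V: "finite V" and R_subset: "R \<subseteq> V"
    and T_subset: "T \<subseteq> Pow V" and no_root_edge: "edges_in T R = {}"
    and disjoint_classes: "disjoint_family_on C V"
    and card_root_class: "\<And>x. x \<in> R \<Longrightarrow> card (C x) = 1"
    and card_class: "\<And>x. x \<in> V - R \<Longrightarrow> card (C x) = w" and w_pos: "0 < w"
begin

lemma finite_T: "finite T"
  using T_subset finite_V by (simp add: finite_subset)

lemma finite_class: "x \<in> V \<Longrightarrow> finite (C x)"
  using card_root_class card_class w_pos by (cases "x \<in> R") (auto intro: card_ge_0_finite)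

lemma finite_embeddings: "finite (Pi\<^sub>E V C)"
  using finite_V finite_class by (rule finite_PiE)

lemma card_embeddings: "card (Pi\<^sub>E V C) = w ^ card (V - R)"
proof -
  have "card (Pi\<^sub>E V C) = (\<Prod>x\<in>V. card (C x))"
    using finite_V by (rule card_PiE)
  also have "\<dots> = (\<Prod>x\<in>R. card (C x)) * (\<Prod>x\<in>V - R. card (C x))"
    using finite_V R_subset by (metis mult.commute prod.subset_diff)
  finally show ?thesis
    using card_root_class card_class by simp
qed

lemma roots_agree:
  assumes "\<phi> \<in> Pi\<^sub>E V C" "\<psi> \<in> Pi\<^sub>E V C"
  shows "R \<subseteq> {x \<in> V. \<phi> x = \<psi> x}"
proof
  fix x assume "x \<in> R"
  moreover from this obtain c where "C x = {c}"
    using card_root_class card_1_singletonE by blast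
  ultimately show "x \<in> {x \<in> V. \<phi> x = \<psi> x}"
    using assms R_subset PiE_mem[of \<phi> V C x] PiE_mem[of \<psi> V C x] by auto
qed

lemma overlap_sum_all:
  "(\<Sum>A | R \<subseteq> A \<and> A \<subseteq> V. (1 / w) ^ card (A - R) * (1 / p) ^ card (edges_in T A))
    = 1 + overlap_sum V T R w p"
proof -
  have "{A. R \<subseteq> A \<and> A \<subseteq> V} = insert R {A. R \<subset> A \<and> A \<subseteq> V}"
    using R_subset by blast
  moreover have "finite {A. R \<subset> A \<and> A \<subseteq> V}"
    by (rule finite_subset[of _ "Pow V"]) (use finite_V in auto)
  ultimately show ?thesis
    unfolding overlap_sum_def by (simp add: no_root_edge)
qed

lemma sum_overlaps_le:
  assumes \<phi>: "\<phi> \<in> Pi\<^sub>E V C" and p: "0 < p" "p \<le> 1"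
  shows "(\<Sum>\<psi>\<in>Pi\<^sub>E V C. (1 / p) ^ card ((`) \<phi> ` T \<inter> (`) \<psi> ` T))
    \<le> real w ^ card (V - R) * (1 + overlap_sum V T R w p)"
proof -
  let ?agree = "\<lambda>\<psi>. {x \<in> V. \<phi> x = \<psi> x}" and ?\<A> = "{A. R \<subseteq> A \<and> A \<subseteq> V}"
  let ?f = "\<lambda>A. (1 / p) ^ card (edges_in T A)"
  have "(\<Sum>\<psi>\<in>Pi\<^sub>E V C. (1 / p) ^ card ((`) \<phi> ` T \<inter> (`) \<psi> ` T)) \<le> (\<Sum>\<psi>\<in>Pi\<^sub>E V C. ?f (?agree \<psi>))"
    using p card_image_copies_Int_le[OF disjoint_classes \<phi> _ finite_T T_subset]
    by (intro sum_mono power_increasing) auto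
  also have "\<dots> = (\<Sum>A\<in>?\<A>. \<Sum>\<psi> | \<psi> \<in> Pi\<^sub>E V C \<and> ?agree \<psi> = A. ?f (?agree \<psi>))"
    using finite_embeddings finite_V roots_agree[OF \<phi>]
    by (intro sum.group[symmetric] finite_subset[of ?\<A> "Pow V"]) auto
  also have "\<dots> = (\<Sum>A\<in>?\<A>. real (card {\<psi> \<in> Pi\<^sub>E V C. ?agree \<psi> = A}) * ?f A)"
    by (intro sum.cong refl) simp
  also have "\<dots> \<le> (\<Sum>A\<in>?\<A>. real w ^ card (V - R) * ((1 / w) ^ card (A - R) * ?f A))"
  proof (rule sum_mono)
    fix A assume A: "A \<in> ?\<A>"
    have "card (V - R) = card (A - R) + card (V - A)"
      using A finite_V
      by (subst card_Un_disjoint[symmetric]) (auto intro: finite_subset arg_cong[where f = card])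
    then have "real w ^ card (V - A) = real w ^ card (V - R) * (1 / w) ^ card (A - R)"
      using w_pos by (simp add: power_add power_divide)
    moreover have "real (card {\<psi> \<in> Pi\<^sub>E V C. ?agree \<psi> = A}) \<le> real w ^ card (V - A)"
      unfolding of_nat_power[symmetric] of_nat_le_iff
      using A by (intro card_PiE_agreeing_le[OF finite_V \<phi> _ _ finite_class card_class, of A]) auto
    ultimately show "real (card {\<psi> \<in> Pi\<^sub>E V C. ?agree \<psi> = A}) * ?f A
        \<le> real w ^ card (V - R) * ((1 / w) ^ card (A - R) * ?f A)"
      using p by (simp add: mult_right_mono mult.assoc[symmetric])
  qed
  also have "\<dots> = real w ^ card (V - R) * (1 + overlap_sum V T R w p)"
    by (simp only: sum_distrib_left[symmetric] overlap_sum_all)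
  finally show ?thesis .
qed

lemma card_embedded_template:
  assumes "\<phi> \<in> Pi\<^sub>E V C"
  shows "card ((`) \<phi> ` T) = card T"
  using PiE_disjoint_image_eqD(1)[OF disjoint_classes assms assms] T_subset
  by (intro card_image inj_onI) (blast dest: subsetD)

lemma embedded_templates_disjoint:
  assumes \<phi>: "\<phi> \<in> Pi\<^sub>E V C" and \<psi>: "\<psi> \<in> Pi\<^sub>E V C'"
    and disjoint: "\<And>x y. x \<in> V - R \<Longrightarrow> y \<in> V \<Longrightarrow> C x \<inter> C' y = {}"
  shows "(`) \<phi> ` T \<inter> (`) \<psi> ` T = {}"
proof -
  have False if t: "t \<in> T" "t' \<in> T" "\<phi> ` t = \<psi> ` t'" for t t'
  proof -
    obtain x where x: "x \<in> t" "x \<in> V - R"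
      using no_root_edge T_subset t(1) unfolding edges_in_def by blast
    moreover obtain y where "y \<in> V" "\<phi> x = \<psi> y"
      using x(1) t(2,3) T_subset by blast
    ultimately show False
      using disjoint[of x y] PiE_mem[OF \<phi>, of x] PiE_mem[OF \<psi>, of y] by auto
  qed
  then show ?thesis by auto
qed

lemma prob_no_embedding_le_overlap_sum:
  assumes E: "finite E" "\<And>\<phi>. \<phi> \<in> Pi\<^sub>E V C \<Longrightarrow> (`) \<phi> ` T \<subseteq> E" and p: "0 < p" "p \<le> 1"
  shows "measure_pmf.prob (random_subset p E) {G. \<forall>\<phi>\<in>Pi\<^sub>E V C. \<not> (`) \<phi> ` T \<subseteq> G} \<le> overlap_sum V T R w p"
proof -
  let ?W = "real w ^ card (V - R)" and ?o = "overlap_sum V T R w p"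
  have W: "0 < ?W" "real (card (Pi\<^sub>E V C)) = ?W"
    using w_pos by (simp_all add: card_embeddings)
  have "measure_pmf.prob (random_subset p E) {G. \<forall>\<phi>\<in>Pi\<^sub>E V C. \<not> (`) \<phi> ` T \<subseteq> G}
    \<le> (\<Sum>\<phi>\<in>Pi\<^sub>E V C. \<Sum>\<psi>\<in>Pi\<^sub>E V C. (1 / p) ^ card ((`) \<phi> ` T \<inter> (`) \<psi> ` T)) / ?W\<^sup>2 - 1"
    unfolding W(2)[symmetric]
  proof (rule prob_no_subset_le_second_moment[OF E(1) finite_embeddings _ p E(2) card_embedded_template])
    show "Pi\<^sub>E V C \<noteq> {}"
      using W by (metis card.empty less_irrefl of_nat_0)
  qed
  also have "\<dots> \<le> ?o"
  proof -
    have "(\<Sum>\<phi>\<in>Pi\<^sub>E V C. \<Sum>\<psi>\<in>Pi\<^sub>E V C. (1 / p) ^ card ((`) \<phi> ` T \<inter> (`) \<psi> ` T))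
        \<le> (\<Sum>\<phi>\<in>Pi\<^sub>E V C. ?W * (1 + ?o))"
      by (intro sum_mono sum_overlaps_le p)
    also have "\<dots> = (1 + ?o) * ?W\<^sup>2"
      using W by (simp add: power2_eq_square mult_ac)
    finally have "(\<Sum>\<phi>\<in>Pi\<^sub>E V C. \<Sum>\<psi>\<in>Pi\<^sub>E V C. (1 / p) ^ card ((`) \<phi> ` T \<inter> (`) \<psi> ` T)) / ?W\<^sup>2 \<le> 1 + ?o"
      using W(1) by (intro mult_imp_div_pos_le) auto
    then show ?thesis by simp
  qed
  finally show ?thesis .
qed

end

lemma ex_disjoint_family_card:
  assumes "finite J" "finite X" "card J * w \<le> card X"
  obtains D where "disjoint_family_on D J" "\<And>j. j \<in> J \<Longrightarrow> D j \<subseteq> X" "\<And>j. j \<in> J \<Longrightarrow> card (D j) = w"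
proof -
  have "card (J \<times> {..<w}) \<le> card X"
    using assms(3) by (simp add: card_cartesian_product)
  then obtain h where h: "h ` (J \<times> {..<w}) \<subseteq> X" "inj_on h (J \<times> {..<w})"
    using card_le_inj[of "J \<times> {..<w}" X] assms(1,2) by auto
  show thesis
  proof (rule that[of "\<lambda>j. h ` ({j} \<times> {..<w})"])
    show "disjoint_family_on (\<lambda>j. h ` ({j} \<times> {..<w})) J"
      using h(2) unfolding disjoint_family_on_def inj_on_def by fastforce
    show "h ` ({j} \<times> {..<w}) \<subseteq> X" if "j \<in> J" for j
      using h(1) that by blast
    show "card (h ` ({j} \<times> {..<w})) = w" if "j \<in> J" for j
      using h(2) that by (subst card_image) (auto intro: inj_on_subset simp: card_cartesian_product)
  qed
qed

lemma prob_no_embedding_le_power: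
  assumes J: "finite J" and template: "\<And>j. j \<in> J \<Longrightarrow> rooted_template V R T (C j) w"
    and disjoint: "\<And>i j x y. i \<in> J \<Longrightarrow> j \<in> J \<Longrightarrow> i \<noteq> j \<Longrightarrow> x \<in> V - R \<Longrightarrow> y \<in> V \<Longrightarrow> C i x \<inter> C j y = {}"
    and E: "finite E" "\<And>j \<phi>. j \<in> J \<Longrightarrow> \<phi> \<in> Pi\<^sub>E V (C j) \<Longrightarrow> (`) \<phi> ` T \<subseteq> E"
    and p: "0 < p" "p \<le> 1"
  shows "measure_pmf.prob (random_subset p E) {G. \<forall>j\<in>J. \<forall>\<phi>\<in>Pi\<^sub>E V (C j). \<not> (`) \<phi> ` T \<subseteq> G}
    \<le> overlap_sum V T R w p ^ card J"
proof -
  let ?q = "random_subset p E"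
  define B where "B j = (\<Union>\<phi>\<in>Pi\<^sub>E V (C j). (`) \<phi> ` T)" for j
  have B_E: "B j \<subseteq> E" if "j \<in> J" for j
    using E(2)[OF that] unfolding B_def by blast
  have B_disj: "disjoint_family_on B J"
    unfolding disjoint_family_on_def
  proof (intro ballI impI)
    fix i j assume ij: "i \<in> J" "j \<in> J" "i \<noteq> j"
    have "(`) \<phi> ` T \<inter> (`) \<psi> ` T = {}" if "\<phi> \<in> Pi\<^sub>E V (C i)" "\<psi> \<in> Pi\<^sub>E V (C j)" for \<phi> \<psi>
      by (rule rooted_template.embedded_templates_disjoint[OF template[OF ij(1)] that disjoint[OF ij]])
    then show "B i \<inter> B j = {}"
      unfolding B_def by blast
  qed
  have restrict: "(`) \<phi> ` T \<subseteq> G \<inter> B j \<longleftrightarrow> (`) \<phi> ` T \<subseteq> G" if "\<phi> \<in> Pi\<^sub>E V (C j)" for \<phi> j G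
    using that unfolding B_def by blast
  have "measure_pmf.prob ?q {G. \<forall>j\<in>J. \<forall>\<phi>\<in>Pi\<^sub>E V (C j). \<not> (`) \<phi> ` T \<subseteq> G}
      = measure_pmf.prob ?q {G. \<forall>j\<in>J. \<forall>\<phi>\<in>Pi\<^sub>E V (C j). \<not> (`) \<phi> ` T \<subseteq> G \<inter> B j}"
    by (simp only: restrict cong: ball_cong)
  also have "\<dots> = (\<Prod>j\<in>J. measure_pmf.prob ?q {G. \<forall>\<phi>\<in>Pi\<^sub>E V (C j). \<not> (`) \<phi> ` T \<subseteq> G \<inter> B j})"
    by (rule prob_random_subset_disjoint_blocks[OF E(1) B_E B_disj J])
  also have "\<dots> = (\<Prod>j\<in>J. measure_pmf.prob ?q {G. \<forall>\<phi>\<in>Pi\<^sub>E V (C j). \<not> (`) \<phi> ` T \<subseteq> G})"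
    by (simp only: restrict cong: ball_cong)
  also have "\<dots> \<le> (\<Prod>j\<in>J. overlap_sum V T R w p)"
    by (intro prod_mono conjI rooted_template.prob_no_embedding_le_overlap_sum template E p) auto
  finally show ?thesis by simp
qed

lemma rooted_template_root_classes:
  assumes V: "finite V" "R \<subseteq> V" "T \<subseteq> Pow V" "edges_in T R = {}" and h: "inj_on h R"
    and D: "disjoint_family_on D (V - R)" "\<And>x. x \<in> V - R \<Longrightarrow> card (D x) = w" "0 < w"
    and hD: "\<And>x. x \<in> V - R \<Longrightarrow> D x \<inter> h ` R = {}"
  shows "rooted_template V R T (\<lambda>x. if x \<in> R then {h x} else D x) w"
proof
  show "disjoint_family_on (\<lambda>x. if x \<in> R then {h x} else D x) V"
    unfolding disjoint_family_on_def
  proof (intro ballI impI)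
    fix x y assume "x \<in> V" "y \<in> V" "x \<noteq> y"
    then show "(if x \<in> R then {h x} else D x) \<inter> (if y \<in> R then {h y} else D y) = {}"
      using hD[of x] hD[of y] inj_onD[OF h, of x y] disjoint_family_onD[OF D(1), of x y]
      by (cases "x \<in> R"; cases "y \<in> R") auto
  qed
qed (use V D(2,3) in auto)

lemma ex_rooted_template_family:
  assumes V: "finite V" "R \<subseteq> V" "T \<subseteq> Pow V" "edges_in T R = {}"
    and X: "finite X" "Y \<subseteq> X" and R: "card Y = card R"
    and w: "0 < w" "K * card (V - R) * w \<le> card (X - Y)"
  obtains C where
    "\<And>j. j < K \<Longrightarrow> rooted_template V R T (C j) w"
    "\<And>j x. j < K \<Longrightarrow> x \<in> V \<Longrightarrow> C j x \<subseteq> X"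
    "\<And>i j x y. i < K \<Longrightarrow> j < K \<Longrightarrow> i \<noteq> j \<Longrightarrow> x \<in> V - R \<Longrightarrow> y \<in> V \<Longrightarrow> C i x \<inter> C j y = {}"
    "\<And>j \<phi>. \<phi> \<in> Pi\<^sub>E V (C j) \<Longrightarrow> \<phi> ` R = Y"
proof -
  have "finite R" "finite Y"
    using finite_subset V(1,2) X by blast+
  then obtain h where h: "bij_betw h R Y"
    using finite_same_card_bij[of R Y] R by auto
  let ?I = "{..<K} \<times> (V - R)"
  have "card ?I * w \<le> card (X - Y)"
    using w(2) by (simp add: card_cartesian_product)
  then obtain D where D: "disjoint_family_on D ?I"
    "\<And>z. z \<in> ?I \<Longrightarrow> D z \<subseteq> X - Y" "\<And>z. z \<in> ?I \<Longrightarrow> card (D z) = w"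
    using ex_disjoint_family_card[of ?I "X - Y" w] V X by auto
  define C where "C j x = (if x \<in> R then {h x} else D (j, x))" for j x
  have h_R: "h ` R = Y" "inj_on h R"
    using h unfolding bij_betw_def by auto
  show thesis
  proof (rule that)
    fix j assume j: "j < K"
    have "disjoint_family_on (\<lambda>x. D (j, x)) (V - R)"
      using D(1) j unfolding disjoint_family_on_def by auto
    then show "rooted_template V R T (C j) w"
      unfolding C_def using D(2)[of "(j, _)"] D(3) h_R j w(1)
      by (intro rooted_template_root_classes V) auto
    show "C j x \<subseteq> X" if "x \<in> V" for x
      using that j h_R(1) D(2)[of "(j, x)"] X(2) unfolding C_def by auto
  next
    fix i j x y assume "i < K" "j < K" "i \<noteq> j" "x \<in> V - R" "y \<in> V"
    then show "C i x \<inter> C j y = {}"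
      using h_R(1) D(2)[of "(i, x)"] disjoint_family_onD[OF D(1), of "(i, x)" "(j, y)"]
      unfolding C_def by (cases "y \<in> R") auto
  next
    fix j \<phi> assume "\<phi> \<in> Pi\<^sub>E V (C j)"
    then have "\<phi> x = h x" if "x \<in> R" for x
      using that V(2) PiE_mem[of \<phi> V "C j" x] unfolding C_def by auto
    then show "\<phi> ` R = Y"
      unfolding h_R(1)[symmetric] by (rule image_cong[OF refl])
  qed
qed

section \<open>Percolation\<close>

lemma all_edges_altdef: "all_edges n = {e. e \<subseteq> {0..<n} \<and> card e = 2}"
  unfolding all_edges_def by (force simp: card_2_iff)

lemma finite_all_edges [simp]: "finite (all_edges n)"
  unfolding all_edges_altdef by (rule finite_subset[of _ "Pow {0..<n}"]) auto

lemma card_all_edges: "card (all_edges n) = n choose 2"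
  unfolding all_edges_altdef using n_subsets[of "{0..<n}" 2] by simp

lemma image_mem_all_edges:
  assumes "inj_on f V" "f ` V \<subseteq> {0..<n}" "e \<subseteq> V" "card e = 2"
  shows "f ` e \<in> all_edges n"
  using assms card_image[OF inj_on_subset[OF assms(1,3)]] unfolding all_edges_altdef by auto

lemma gnp_prob_eq_random_subset:
  assumes "0 \<le> p" "p \<le> 1"
  shows "gnp_prob n p P = measure_pmf.prob (random_subset p (all_edges n)) {G. P G}"
proof -
  let ?q = "random_subset p (all_edges n)" and ?\<G> = "{G. G \<subseteq> all_edges n \<and> P G}"
  have "gnp_prob n p P = (\<Sum>G\<in>?\<G>. pmf ?q G)"
    unfolding gnp_prob_def using assms by (intro sum.cong refl) (simp add: pmf_random_subset)
  also have "\<dots> = measure_pmf.prob ?q ?\<G>"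
    by (rule measure_measure_pmf_finite[symmetric]) (simp add: finite_subset[of _ "Pow (all_edges n)"])
  also have "\<dots> = measure_pmf.prob ?q {G. P G}"
    using set_random_subset by (intro measure_prob_cong_0) (auto simp: pmf_eq_0_set_pmf)
  finally show ?thesis .
qed

abbreviation perc_prob :: "nat \<Rightarrow> nat \<Rightarrow> nat set set \<Rightarrow> real \<Rightarrow> real" where
  "perc_prob n k EH p \<equiv> gnp_prob n p (\<lambda>G. perc_closure n k EH G = all_edges n)"

lemma perc_steps_mono: "s \<le> t \<Longrightarrow> (perc_step n k EH ^^ s) G \<subseteq> (perc_step n k EH ^^ t) G"
proof (induction rule: dec_induct)
  case (step t)
  then show ?case by (auto simp: perc_step_def)
qed simp

lemma perc_closure_superset: "G \<subseteq> perc_closure n k EH G"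
proof -
  have "(perc_step n k EH ^^ 0) G \<subseteq> perc_closure n k EH G"
    unfolding perc_closure_def by blast
  then show ?thesis by simp
qed

lemma finite_subset_perc_closure:
  assumes "finite X" "X \<subseteq> perc_closure n k EH G"
  obtains t where "X \<subseteq> (perc_step n k EH ^^ t) G"
proof -
  have "\<exists>t. X \<subseteq> (perc_step n k EH ^^ t) G"
    using assms
  proof (induction rule: finite_induct)
    case (insert x X)
    then obtain s t where "X \<subseteq> (perc_step n k EH ^^ s) G" "x \<in> (perc_step n k EH ^^ t) G"
      unfolding perc_closure_def by auto
    then have "insert x X \<subseteq> (perc_step n k EH ^^ max s t) G"
      using perc_steps_mono[of s "max s t" n k EH G] perc_steps_mono[of t "max s t" n k EH G] by auto
    then show ?case ..
  qed simp
  then show thesis using that by blast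
qed

lemma perc_closure_closed:
  assumes EH: "EH \<subseteq> all_edges k" and f: "inj_on f {0..<k}" "f ` {0..<k} \<subseteq> {0..<n}"
    and x0: "x0 \<in> EH" and copy: "(`) f ` (EH - {x0}) \<subseteq> perc_closure n k EH G"
  shows "f ` x0 \<in> perc_closure n k EH G"
proof -
  have "finite EH"
    using EH finite_subset by fastforce
  then obtain t where t: "(`) f ` (EH - {x0}) \<subseteq> (perc_step n k EH ^^ t) G" (is "_ \<subseteq> ?X")
    using copy by (auto elim: finite_subset_perc_closure[rotated])
  have "f ` x0 \<in> all_edges n"
    using EH x0 by (intro image_mem_all_edges[OF f]) (auto simp: all_edges_altdef)
  moreover have "\<forall>x\<in>EH. f ` x \<in> ?X \<union> {f ` x0}"
    using t by blast
  then have "has_copy_containing n k EH (?X \<union> {f ` x0}) (f ` x0)"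
    unfolding has_copy_containing_def using f x0 by blast
  ultimately have "f ` x0 \<in> (perc_step n k EH ^^ Suc t) G"
    by (auto simp: perc_step_def)
  then show ?thesis
    unfolding perc_closure_def by blast
qed

lemma has_copy_containing_mono:
  assumes "has_copy_containing n k EH G e" "G \<subseteq> G'"
  shows "has_copy_containing n k EH G' e"
  using assms unfolding has_copy_containing_def by blast

lemma perc_closure_least:
  assumes "G \<subseteq> X"
    and closed: "\<And>e. e \<in> all_edges n \<Longrightarrow> has_copy_containing n k EH (X \<union> {e}) e \<Longrightarrow> e \<in> X"
  shows "perc_closure n k EH G \<subseteq> X"
proof -
  have "(perc_step n k EH ^^ t) G \<subseteq> X" for t
  proof (induction t)
    case (Suc t)
    have "e \<in> X"
      if "e \<in> all_edges n" "has_copy_containing n k EH ((perc_step n k EH ^^ t) G \<union> {e}) e" for e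
      using Suc by (intro closed[OF that(1)] has_copy_containing_mono[OF that(2)]) blast
    then have "perc_step n k EH ((perc_step n k EH ^^ t) G) \<subseteq> X"
      using Suc unfolding perc_step_def[of n k EH "(perc_step n k EH ^^ t) G"] by blast
    then show ?case by simp
  qed (use assms in simp)
  then show ?thesis
    unfolding perc_closure_def by blast
qed

lemma perc_closure_subset: "G \<subseteq> all_edges n \<Longrightarrow> perc_closure n k EH G \<subseteq> all_edges n"
  by (rule perc_closure_least)

section \<open>Balanced graphs\<close>

lemma lambda_H_mult: "3 \<le> k \<Longrightarrow> lambda_H k EH * (real k - 2) = real (card EH) - 2"
  unfolding lambda_H_def by simp

locale balanced_graph =
  fixes k :: nat and EH :: "nat set set"
  assumes edges: "EH \<subseteq> all_edges k" and k_ge_3: "3 \<le> k" and lambda_ge_1: "1 \<le> lambda_H k EH"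
    and card_edges_in_le: "\<And>F. F \<subset> {0..<k} \<Longrightarrow> 2 \<le> card F \<Longrightarrow>
      real (card (edges_in EH F)) \<le> lambda_H k EH * (real (card F) - 2) + 1"
begin

abbreviation \<Lambda> :: real where "\<Lambda> \<equiv> lambda_H k EH"

lemma edgeD: "x \<in> EH \<Longrightarrow> x \<subseteq> {0..<k}" "x \<in> EH \<Longrightarrow> card x = 2"
  using edges unfolding all_edges_altdef by auto

lemma finite_edges: "finite EH"
  using edges by (rule finite_subset) simp

lemma card_edges: "real (card EH) = \<Lambda> * (real k - 2) + 2"
  using lambda_H_mult[OF k_ge_3, of EH] by simp

lemma card_edges_ge_3: "3 \<le> card EH"
proof -
  have "1 * 1 \<le> \<Lambda> * (real k - 2)"
    using lambda_ge_1 k_ge_3 by (intro mult_mono) auto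
  then have "3 \<le> real (card EH)"
    using card_edges k_ge_3 by simp
  then show ?thesis by simp
qed

lemma edges_in_eq_empty:
  assumes "finite F" "card F < 2"
  shows "edges_in EH F = {}"
proof -
  have "\<not> x \<subseteq> F" if "x \<in> EH" for x
    using assms edgeD(2)[OF that] card_mono[of F x] by auto
  then show ?thesis
    unfolding edges_in_def by blast
qed

lemma card_edges_in_remove1_le:
  assumes f: "f \<in> EH" and F: "F \<subset> {0..<k}"
  shows "real (card (edges_in (EH - {f}) F)) \<le> \<Lambda> * real (card (F - f))"
proof -
  have fin: "finite F" "finite f"
    using F edgeD(1)[OF f] finite_subset by blast+
  have remove: "edges_in (EH - {f}) F = edges_in EH F - {f}"
    unfolding edges_in_def by blast
  consider "card F < 2" | "2 \<le> card F" "f \<subseteq> F" | "2 \<le> card F" "\<not> f \<subseteq> F"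
    by linarith
  then show ?thesis
  proof cases
    case 1
    then show ?thesis
      using edges_in_eq_empty[OF fin(1)] lambda_ge_1 by (simp add: remove)
  next
    case 2
    then have "card (edges_in EH F) = card (edges_in (EH - {f}) F) + 1"
      using f finite_edges_in[OF finite_edges] unfolding remove
      by (metis (no_types, lifting) Suc_eq_plus1 card.remove edges_in_def mem_Collect_eq)
    moreover have "real (card (F - f)) = real (card F) - 2"
      using 2 fin edgeD(2)[OF f] by (simp add: card_Diff_subset of_nat_diff)
    ultimately show ?thesis
      using card_edges_in_le[OF F 2(1)] by simp
  next
    case 3
    then have "card (F \<inter> f) < card f"
      using fin by (intro psubset_card_mono) auto
    then have "real (card F) - 1 \<le> real (card (F - f))"
      using edgeD(2)[OF f] fin 3 by (simp add: card_Diff_subset_Int)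
    then have "\<Lambda> * (real (card F) - 1) \<le> \<Lambda> * real (card (F - f))"
      using lambda_ge_1 by (intro mult_left_mono) auto
    moreover have "card (edges_in (EH - {f}) F) \<le> card (edges_in EH F)"
      unfolding remove using finite_edges_in[OF finite_edges] by (intro card_mono) auto
    ultimately show ?thesis
      using card_edges_in_le[OF F 3(1)] lambda_ge_1 by (simp add: algebra_simps)
  qed
qed

lemma card_remove_two_edges:
  assumes "f \<in> EH" "g \<in> EH" "f \<noteq> g"
  shows "real (card (EH - {f, g})) = \<Lambda> * (real k - 2)"
  using assms card_edges card_edges_ge_3 finite_edges by (simp add: card_Diff_subset of_nat_diff)

lemma card_edges_in_remove2_le:
  assumes fg: "f \<in> EH" "g \<in> EH" "f \<noteq> g" and F: "F \<subseteq> {0..<k}"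
  shows "real (card (edges_in (EH - {f, g}) F)) \<le> \<Lambda> * real (card (F - f))"
proof (cases "F = {0..<k}")
  case True
  have "card (edges_in (EH - {f, g}) F) \<le> card (EH - {f, g})"
    using finite_edges unfolding edges_in_def by (intro card_mono) auto
  moreover have "real (card (F - f)) = real k - 2"
    using True edgeD[OF fg(1)] k_ge_3 finite_subset[of f "{0..<k}"]
    by (simp add: card_Diff_subset of_nat_diff)
  ultimately show ?thesis
    using card_remove_two_edges[OF fg] by simp
next
  case False
  then have "F \<subset> {0..<k}"
    using F by blast
  moreover have "card (edges_in (EH - {f, g}) F) \<le> card (edges_in (EH - {f}) F)"
    using finite_edges by (intro card_mono finite_edges_in edges_in_mono) auto
  ultimately show ?thesis
    using card_edges_in_remove1_le[OF fg(1), of F] by linarith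
qed

lemma card_edges_in_remove2_less:
  assumes fg: "f \<in> EH" "g \<in> EH" "f \<noteq> g" and F: "F \<subset> {0..<k}" "g \<subseteq> F"
  shows "real (card (edges_in (EH - {f, g}) F)) + 1 \<le> \<Lambda> * real (card (F - f))"
proof -
  have "g \<in> edges_in (EH - {f}) F" "edges_in (EH - {f, g}) F = edges_in (EH - {f}) F - {g}"
    using fg F(2) unfolding edges_in_def by auto
  then have "card (edges_in (EH - {f}) F) = card (edges_in (EH - {f, g}) F) + 1"
    using finite_edges_in[of "EH - {f}" F] finite_edges by (metis Suc_eq_plus1 card.remove finite_Diff)
  then show ?thesis
    using card_edges_in_remove1_le[OF fg(1) F(1)] by simp
qed

lemma obtain_two_edges:
  obtains f g where "f \<in> EH" "g \<in> EH" "f \<noteq> g"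
proof -
  have "\<not> is_singleton EH" "EH \<noteq> {}"
    using card_edges_ge_3 by (auto simp: is_singleton_def)
  then show thesis
    using that is_singletonI' by metis
qed

end

section \<open>Gadgets\<close>

locale sparse_rooted =
  fixes l :: real and V :: "'v set" and T :: "'v set set" and r :: "'v set"
  assumes finite_V: "finite V" and root_subset: "r \<subseteq> V" and card_root: "card r = 2"
    and edges_subset: "T \<subseteq> Pow V" and card_edge: "\<And>t. t \<in> T \<Longrightarrow> card t = 2"
    and card_T: "real (card T) = l * (real (card V) - 2) + 1"
    and card_edges_in_le: "\<And>B. B \<subset> V \<Longrightarrow> real (card (edges_in T B)) \<le> l * real (card (B - r))"
begin

lemma finite_T: "finite T"
  using edges_subset finite_V by (simp add: finite_subset)

lemma finite_root: "finite r"
  using root_subset finite_V by (rule finite_subset)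

lemma card_nonroot: "real (card (V - r)) = real (card V) - 2"
  using card_mono[OF finite_V root_subset] finite_root root_subset card_root
  by (simp add: card_Diff_subset of_nat_diff)

lemma edges_in_V: "edges_in T V = T"
  using edges_subset unfolding edges_in_def by blast

lemma no_root_edge: "r \<subset> V \<Longrightarrow> edges_in T r = {}"
  using card_edges_in_le[of r] finite_edges_in[OF finite_T, of r] by simp

lemma sparse_rooted_image:
  assumes s: "inj_on s V"
  shows "sparse_rooted l (s ` V) ((`) s ` T) (s ` r)"
proof
  have card_s: "card (s ` A) = card A" if "A \<subseteq> V" for A
    using inj_on_subset[OF s that] by (rule card_image)
  have inj: "inj_on ((`) s) T"
    using inj_on_image_Pow[OF s] edges_subset by (rule inj_on_subset)
  then show "real (card ((`) s ` T)) = l * (real (card (s ` V)) - 2) + 1"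
    using card_T card_s by (simp add: card_image)
  show "card (s ` r) = 2"
    using card_s root_subset card_root by simp
  show "card e = 2" if "e \<in> (`) s ` T" for e
    using that card_s card_edge edges_subset by auto
  fix B assume B: "B \<subset> s ` V"
  define A where "A = {x \<in> V. s x \<in> B}"
  have A: "B = s ` A" "A \<subset> V"
    using B unfolding A_def by auto
  have "edges_in ((`) s ` T) B \<subseteq> (`) s ` edges_in T A"
    using edges_subset unfolding edges_in_def A_def by (auto intro!: imageI)
  then have "card (edges_in ((`) s ` T) B) \<le> card (edges_in T A)"
    using finite_T by (intro surj_card_le finite_edges_in)
  also have "real (card (edges_in T A)) \<le> l * real (card (A - r))"
    by (rule card_edges_in_le[OF A(2)])
  also have "card (A - r) = card (B - s ` r)"
  proof -
    have "B - s ` r = s ` (A - r)"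
      unfolding A(1) using A(2) root_subset by (intro inj_on_image_set_diff[OF s, symmetric]) auto
    then show ?thesis
      using A(2) by (simp add: card_s subset_iff psubset_eq)
  qed
  finally show "real (card (edges_in ((`) s ` T) B)) \<le> l * real (card (B - s ` r))"
    by simp
qed (use finite_V root_subset edges_subset in auto)

end

lemma sparse_rooted_single_edge:
  assumes "card r = 2"
  shows "sparse_rooted l r {r} r"
proof
  show "real (card (edges_in {r} B)) \<le> l * real (card (B - r))" if "B \<subset> r" for B
  proof -
    have "edges_in {r} B = {}" "card (B - r) = 0"
      using that unfolding edges_in_def by (auto simp: card_eq_0_iff)
    then show ?thesis by simp
  qed
qed (use assms card_ge_0_finite[of r] in auto)

definition infects_root :: "nat \<Rightarrow> nat set set \<Rightarrow> 'v set \<Rightarrow> 'v set set \<Rightarrow> 'v set \<Rightarrow> bool" where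
  "infects_root k EH V T r \<longleftrightarrow> (\<forall>n \<phi> G. inj_on \<phi> V \<longrightarrow> \<phi> ` V \<subseteq> {0..<n} \<longrightarrow> (`) \<phi> ` T \<subseteq> G \<longrightarrow>
     \<phi> ` r \<in> perc_closure n k EH G)"

lemma infects_rootD:
  assumes "infects_root k EH V T r" "inj_on \<phi> V" "\<phi> ` V \<subseteq> {0..<n}" "(`) \<phi> ` T \<subseteq> G"
  shows "\<phi> ` r \<in> perc_closure n k EH G"
  using assms unfolding infects_root_def by blast

lemma infects_root_single_edge: "infects_root k EH r {r} r"
  unfolding infects_root_def using perc_closure_superset by fastforce

lemma infects_root_image:
  assumes s: "inj_on s V" and inf: "infects_root k EH V T r"
  shows "infects_root k EH (s ` V) ((`) s ` T) (s ` r)"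
  unfolding infects_root_def
proof (intro allI impI)
  fix n and \<phi> :: "'b \<Rightarrow> nat" and G
  assume \<phi>: "inj_on \<phi> (s ` V)" "\<phi> ` s ` V \<subseteq> {0..<n}" "(`) \<phi> ` (`) s ` T \<subseteq> G"
  have "(\<phi> \<circ> s) ` r \<in> perc_closure n k EH G"
    using \<phi> by (intro infects_rootD[OF inf] comp_inj_on[OF s]) (auto simp: image_comp)
  then show "\<phi> ` s ` r \<in> perc_closure n k EH G"
    by (simp add: image_comp)
qed

locale gadget = sparse_rooted "lambda_H k EH" V T r
  for k :: nat and EH :: "nat set set" and V :: "'v set" and T :: "'v set set" and r :: "'v set" +
  assumes infects: "infects_root k EH V T r"

lemma gadget_image:
  assumes s: "inj_on s V" and "gadget k EH V T r"
  shows "gadget k EH (s ` V) ((`) s ` T) (s ` r)"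
proof -
  interpret gadget k EH V T r
    by fact
  show ?thesis
    by (intro gadget.intro gadget_axioms.intro sparse_rooted_image infects_root_image s infects)
qed

lemma card_Diff_Int_add_le:
  assumes "V \<inter> W = g" "f \<subseteq> W" "finite B"
  shows "card (B \<inter> V - g) + card (B \<inter> W - f) \<le> card (B - f)"
proof -
  have "card (B \<inter> V - g) + card (B \<inter> W - f) = card ((B \<inter> V - g) \<union> (B \<inter> W - f))"
    using assms by (intro card_Un_disjoint[symmetric]) auto
  also have "\<dots> \<le> card (B - f)"
    using assms by (intro card_mono) auto
  finally show ?thesis .
qed

context balanced_graph
begin

lemma card_edges_in_glue_le:
  assumes fg: "f \<in> EH" "g \<in> EH" "f \<noteq> g"
    and sparse: "sparse_rooted \<Lambda> V T g" and V: "V \<inter> {0..<k} = g" and B: "B \<subset> V \<union> {0..<k}"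
  shows "real (card (edges_in (T \<union> (EH - {f, g})) B)) \<le> \<Lambda> * real (card (B - f))"
proof -
  interpret gad: sparse_rooted \<Lambda> V T g
    by fact
  define C where "C = B \<inter> V"
  define F where "F = B \<inter> {0..<k}"
  have "edges_in (T \<union> (EH - {f, g})) B = edges_in T C \<union> edges_in (EH - {f, g}) F"
    using gad.edges_subset edgeD(1) unfolding edges_in_def C_def F_def by auto
  then have "card (edges_in (T \<union> (EH - {f, g})) B)
      \<le> card (edges_in T C) + card (edges_in (EH - {f, g}) F)"
    by (simp add: card_Un_le)
  moreover have "real (card (edges_in T C)) + real (card (edges_in (EH - {f, g}) F))
      \<le> \<Lambda> * real (card (C - g)) + \<Lambda> * real (card (F - f))"
  proof (cases "C = V")
    case False
    then have "C \<subset> V" "F \<subseteq> {0..<k}"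
      unfolding C_def F_def by auto
    then show ?thesis
      using gad.card_edges_in_le card_edges_in_remove2_le[OF fg] by (intro add_mono)
  next
    case True
    then have "V \<subseteq> B"
      unfolding C_def by blast
    then have "real (card (edges_in (EH - {f, g}) F)) + 1 \<le> \<Lambda> * real (card (F - f))"
      using B V by (intro card_edges_in_remove2_less[OF fg]) (auto simp: F_def)
    then show ?thesis
      using gad.card_T gad.card_nonroot gad.edges_in_V True by simp
  qed
  moreover have "finite B"
    using B gad.finite_V finite_subset by blast
  then have "\<Lambda> * real (card (C - g) + card (F - f)) \<le> \<Lambda> * real (card (B - f))"
    unfolding C_def F_def using lambda_ge_1
    by (intro mult_left_mono of_nat_mono card_Diff_Int_add_le[OF V edgeD(1)[OF fg(1)]]) auto
  ultimately show ?thesis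
    by (simp add: algebra_simps)
qed

lemma sparse_rooted_glue:
  assumes fg: "f \<in> EH" "g \<in> EH" "f \<noteq> g"
    and sparse: "sparse_rooted \<Lambda> V T g" and V: "V \<inter> {0..<k} = g"
  shows "sparse_rooted \<Lambda> (V \<union> {0..<k}) (T \<union> (EH - {f, g})) f"
proof
  interpret gad: sparse_rooted \<Lambda> V T g
    by fact
  have disjoint: "T \<inter> (EH - {f, g}) = {}"
  proof -
    have "t = g" if t: "t \<in> T" "t \<in> EH" for t
    proof (rule card_subset_eq[OF gad.finite_root])
      show "t \<subseteq> g"
        using t gad.edges_subset edgeD(1)[OF t(2)] V by blast
    qed (use t gad.card_edge gad.card_root in auto)
    then show ?thesis by blast
  qed
  have "card V + k = card (V \<union> {0..<k}) + 2"
    using card_Un_Int[of V "{0..<k}"] gad.finite_V gad.card_root V by simp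
  then have card_V: "real (card (V \<union> {0..<k})) - 2 = (real (card V) - 2) + (real k - 2)"
    by linarith
  have card_T: "card (T \<union> (EH - {f, g})) = card T + card (EH - {f, g})"
    using gad.finite_T finite_edges disjoint by (intro card_Un_disjoint) auto
  show "real (card (T \<union> (EH - {f, g}))) = \<Lambda> * (real (card (V \<union> {0..<k})) - 2) + 1"
    unfolding card_V card_T of_nat_add distrib_left gad.card_T card_remove_two_edges[OF fg] by simp
  show "finite (V \<union> {0..<k})"
    using gad.finite_V by simp
  show "f \<subseteq> V \<union> {0..<k}" "card f = 2"
    using edgeD[OF fg(1)] by auto
  show "T \<union> (EH - {f, g}) \<subseteq> Pow (V \<union> {0..<k})"
    using gad.edges_subset edgeD(1) by blast
  show "card t = 2" if "t \<in> T \<union> (EH - {f, g})" for t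
    using that gad.card_edge edgeD(2) by blast
  show "real (card (edges_in (T \<union> (EH - {f, g})) B)) \<le> \<Lambda> * real (card (B - f))"
    if "B \<subset> V \<union> {0..<k}" for B
    using fg sparse V that by (rule card_edges_in_glue_le)
qed

lemma infects_root_glue:
  assumes fg: "f \<in> EH" "g \<in> EH" "f \<noteq> g" and inf: "infects_root k EH V T g"
  shows "infects_root k EH (V \<union> {0..<k}) (T \<union> (EH - {f, g})) f"
  unfolding infects_root_def
proof (intro allI impI)
  fix n and \<phi> :: "nat \<Rightarrow> nat" and G
  assume \<phi>: "inj_on \<phi> (V \<union> {0..<k})" "\<phi> ` (V \<union> {0..<k}) \<subseteq> {0..<n}" "(`) \<phi> ` (T \<union> (EH - {f, g})) \<subseteq> G"
  have "\<phi> ` g \<in> perc_closure n k EH G"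
    using \<phi> by (intro infects_rootD[OF inf] inj_on_subset[OF \<phi>(1)]) auto
  then have "(`) \<phi> ` (EH - {f}) \<subseteq> perc_closure n k EH G"
    using \<phi>(3) perc_closure_superset[of G n k EH] by blast
  then show "\<phi> ` f \<in> perc_closure n k EH G"
    using \<phi>(1,2) fg(1) by (intro perc_closure_closed[OF edges] inj_on_subset[OF \<phi>(1)]) auto
qed

lemma gadget_extend:
  fixes V :: "nat set"
  assumes "gadget k EH V T r"
  shows "\<exists>V' T' r'. gadget k EH (V' :: nat set) T' r' \<and> card V' = card V + (k - 2)"
proof -
  interpret gad: gadget k EH V T r
    by fact
  obtain f g where fg: "f \<in> EH" "g \<in> EH" "f \<noteq> g"
    by (rule obtain_two_edges)
  note g = edgeD[OF fg(2)]
  obtain h where h: "bij_betw h r g"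
    using finite_same_card_bij[of r g] gad.finite_root gad.card_root g finite_subset by auto
  define s where "s x = (if x \<in> r then h x else x + k)" for x
  have s_root: "s x \<in> g" if "x \<in> r" for x
    using h that unfolding s_def by (auto simp: bij_betw_def)
  have s_less: "s x < k \<longleftrightarrow> x \<in> r" for x
    using s_root[of x] g(1) unfolding s_def by auto
  have s_inj: "inj_on s V"
    using h s_less unfolding s_def bij_betw_def inj_on_def by (metis add_right_cancel)
  have s_r: "s ` r = g"
    using h unfolding s_def bij_betw_def by simp
  have s_V: "s ` V \<inter> {0..<k} = g"
    using s_less s_r gad.root_subset g(1) by fastforce
  interpret moved: gadget k EH "s ` V" "(`) s ` T" g
    using gadget_image[OF s_inj assms] unfolding s_r .
  have "gadget k EH (s ` V \<union> {0..<k}) ((`) s ` T \<union> (EH - {f, g})) f"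
    by (intro gadget.intro gadget_axioms.intro sparse_rooted_glue infects_root_glue fg s_V
        moved.sparse_rooted_axioms moved.infects)
  moreover have "card (s ` V \<union> {0..<k}) = card V + (k - 2)"
    using card_Un_Int[of "s ` V" "{0..<k}"] gad.finite_V s_V g(2) s_inj k_ge_3 by (simp add: card_image)
  ultimately show ?thesis by blast
qed

lemma gadget_exists: "\<exists>V T r. gadget k EH (V :: nat set) T r \<and> card V = L * (k - 2) + 2"
proof (induction L)
  case 0
  have "gadget k EH {0, 1 :: nat} {{0, 1}} {0, 1}"
    by (intro gadget.intro gadget_axioms.intro sparse_rooted_single_edge infects_root_single_edge) simp
  then show ?case
    by (intro exI conjI) (assumption, simp)
next
  case (Suc L)
  then obtain V :: "nat set" and T r where "gadget k EH V T r" "card V = L * (k - 2) + 2"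
    by blast
  moreover from gadget_extend[OF this(1)] obtain V' :: "nat set" and T' r'
    where "gadget k EH V' T' r'" "card V' = card V + (k - 2)"
    by blast
  ultimately show ?case
    by (intro exI[of _ V'] exI[of _ T'] exI[of _ r']) simp
qed

end

section \<open>Percolation above the threshold\<close>

lemma (in gadget) prob_not_infected_le:
  assumes r: "r \<subset> V" and f: "f \<in> all_edges n" and p: "0 < p" "p \<le> 1"
    and w: "0 < w" "K * card (V - r) * w \<le> n - 2"
  shows "measure_pmf.prob (random_subset p (all_edges n)) {G. f \<notin> perc_closure n k EH G}
    \<le> overlap_sum V T r w p ^ K"
proof -
  have f': "f \<subseteq> {0..<n}" "card f = card r" "n - 2 = card ({0..<n} - f)"
    using f card_root finite_subset[of f "{0..<n}"]
    unfolding all_edges_altdef by (auto simp: card_Diff_subset)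
  obtain C where C: "\<And>j. j < K \<Longrightarrow> rooted_template V r T (C j) w"
    "\<And>j x. j < K \<Longrightarrow> x \<in> V \<Longrightarrow> C j x \<subseteq> {0..<n}"
    "\<And>i j x y. i < K \<Longrightarrow> j < K \<Longrightarrow> i \<noteq> j \<Longrightarrow> x \<in> V - r \<Longrightarrow> y \<in> V \<Longrightarrow> C i x \<inter> C j y = {}"
    "\<And>j \<phi>. \<phi> \<in> Pi\<^sub>E V (C j) \<Longrightarrow> \<phi> ` r = f"
    by (rule ex_rooted_template_family[OF finite_V root_subset edges_subset no_root_edge[OF r]
          finite_atLeastLessThan f'(1,2) w[unfolded f'(3)]]) (rule that)
  have emb: "inj_on \<phi> V" "\<phi> ` V \<subseteq> {0..<n}" if "j < K" "\<phi> \<in> Pi\<^sub>E V (C j)" for j \<phi>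
    using C(2)[OF that(1)] PiE_mem[OF that(2)]
      PiE_disjoint_inj_on[OF rooted_template.disjoint_classes[OF C(1)[OF that(1)]] that(2)] by blast+
  let ?q = "random_subset p (all_edges n)"
  have "measure_pmf.prob ?q {G. f \<notin> perc_closure n k EH G}
      \<le> measure_pmf.prob ?q {G. \<forall>j\<in>{..<K}. \<forall>\<phi>\<in>Pi\<^sub>E V (C j). \<not> (`) \<phi> ` T \<subseteq> G}"
    using infects_rootD[OF infects emb] C(4) by (intro measure_pmf.finite_measure_mono) fastforce+
  also have "\<dots> \<le> overlap_sum V T r w p ^ card {..<K}"
  proof (rule prob_no_embedding_le_power)
    fix j \<phi> assume "j \<in> {..<K}" "\<phi> \<in> Pi\<^sub>E V (C j)"
    then show "(`) \<phi> ` T \<subseteq> all_edges n"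
      using edges_subset card_edge by (intro image_subsetI image_mem_all_edges[OF emb]) auto
  qed (use C p in auto)
  finally show ?thesis by simp
qed

lemma inverse_nat_div_bigo:
  assumes "0 < m"
  shows "(\<lambda>n. 1 / real ((n - d) div m)) \<in> O(\<lambda>n. 1 / real n)"
proof (rule bigoI)
  show "\<forall>\<^sub>F n in sequentially. norm (1 / real ((n - d) div m)) \<le> real (2 * m) * norm (1 / real n)"
    using eventually_ge_at_top[of "2 * m + 2 * d"]
  proof eventually_elim
    case (elim n)
    let ?w = "(n - d) div m"
    have "n - d < m * ?w + m"
      using dividend_less_times_div[OF assms, of "n - d"] by simp
    then have n: "n < 2 * m * ?w" "0 < n"
      using elim assms by simp_all
    then have "0 < ?w"
      by (metis mult_0_right not_gr_zero not_less_zero)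
    moreover have "real n \<le> real (2 * m * ?w)"
      using n(1) by (simp only: of_nat_le_iff)
    ultimately show ?case
      using n(2) by (simp add: field_simps)
  qed
qed

lemma overlap_sum_bigo:
  fixes w :: "nat \<Rightarrow> real"
  assumes w: "(\<lambda>n. 1 / w n) \<in> O(\<lambda>n. 1 / real n)"
    and exponent: "\<And>A. R \<subset> A \<Longrightarrow> A \<subseteq> V \<Longrightarrow> \<theta> * real (card (edges_in T A)) \<le> real (card (A - R)) - c"
  shows "(\<lambda>n. overlap_sum V T R (w n) (real n powr - \<theta>)) \<in> O(\<lambda>n. real n powr - c)"
  unfolding overlap_sum_def
proof (rule big_sum_in_bigo)
  fix A assume A: "A \<in> {A. R \<subset> A \<and> A \<subseteq> V}"
  let ?a = "card (A - R)" and ?e = "card (edges_in T A)"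
  have "(\<lambda>n. (1 / w n) ^ ?a * (1 / real n powr - \<theta>) ^ ?e)
      \<in> O(\<lambda>n. (1 / real n) ^ ?a * (1 / real n powr - \<theta>) ^ ?e)"
    by (intro landau_o.big.mult_right landau_o.big_power w)
  also have "(\<lambda>n. (1 / real n) ^ ?a * (1 / real n powr - \<theta>) ^ ?e) \<in> O(\<lambda>n. real n powr - c)"
  proof (rule landau_o.big_mono, use eventually_gt_at_top[of 0] in eventually_elim)
    fix n :: nat assume n: "0 < n"
    have "(1 / real n) ^ ?a * (1 / real n powr - \<theta>) ^ ?e = real n powr (\<theta> * real ?e - real ?a)"
      using n by (simp add: powr_minus_divide powr_diff powr_realpow powr_power power_one_over
          power_inverse divide_inverse mult.commute)
    also have "\<dots> \<le> real n powr - c"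
      using n exponent[of A] A by (intro powr_mono) auto
    finally show "norm ((1 / real n) ^ ?a * (1 / real n powr - \<theta>) ^ ?e) \<le> norm (real n powr - c)"
      by simp
  qed
  finally show "(\<lambda>n. (1 / w n) ^ ?a * (1 / real n powr - \<theta>) ^ ?e) \<in> O(\<lambda>n. real n powr - c)" .
qed

lemma square_mult_power_bigo_tendsto_0:
  fixes d :: "nat \<Rightarrow> real"
  assumes d: "d \<in> O(\<lambda>n. real n powr - c)" and K: "2 < c * real K"
  shows "(\<lambda>n. real n ^ 2 * d n ^ K) \<longlonglongrightarrow> 0"
proof -
  have "(\<lambda>n. real n ^ 2 * d n ^ K) \<in> O(\<lambda>n. real n ^ 2 * (real n powr - c) ^ K)"
    by (intro landau_o.big.mult_left landau_o.big_power d)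
  also have "(\<lambda>n. real n ^ 2 * (real n powr - c) ^ K) \<in> o(\<lambda>n. 1)"
  proof -
    have "\<forall>\<^sub>F n in sequentially. real n ^ 2 * (real n powr - c) ^ K = real n powr (2 - c * real K)"
      using eventually_gt_at_top[of 0]
    proof eventually_elim
      case (elim n)
      then show ?case
        using powr_add[of "real n" 2 "- c * real K"] by (simp add: powr_power mult.commute)
    qed
    moreover have "(\<lambda>n. real n powr (2 - c * real K)) \<in> o(\<lambda>n. 1)"
      using K by real_asymp
    ultimately show ?thesis
      by (rule landau_o.small.in_cong[THEN iffD2])
  qed
  finally have "(\<lambda>n. real n ^ 2 * d n ^ K) \<in> o(\<lambda>n. 1)" .
  from smalloD_tendsto[OF this] show ?thesis by simp
qed

lemma (in sparse_rooted) scaled_card_edges_in_le: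
  assumes \<theta>: "0 \<le> \<theta>" "\<theta> * l = 1 - c" and c: "0 \<le> c" and large: "\<theta> + c \<le> c * (real (card V) - 2)"
    and A: "r \<subset> A" "A \<subseteq> V"
  shows "\<theta> * real (card (edges_in T A)) \<le> real (card (A - r)) - c"
proof (cases "A = V")
  case True
  have "\<theta> * real (card (edges_in T A)) = (\<theta> * l) * (real (card V) - 2) + \<theta>"
    unfolding True edges_in_V card_T by (simp add: distrib_left)
  also have "\<dots> = (real (card V) - 2) - (c * (real (card V) - 2) - \<theta>)"
    unfolding \<theta>(2) by (simp add: left_diff_distrib)
  finally show ?thesis
    using large True card_nonroot by simp
next
  case False
  have "finite (A - r)" "A - r \<noteq> {}"
    using A finite_subset[OF A(2) finite_V] by auto
  then have A_r: "1 \<le> real (card (A - r))"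
    by (simp add: Suc_leI card_gt_0_iff)
  have "\<theta> * real (card (edges_in T A)) \<le> \<theta> * (l * real (card (A - r)))"
    using False A(2) \<theta>(1) by (intro mult_left_mono card_edges_in_le) auto
  also have "\<dots> = real (card (A - r)) - c * real (card (A - r))"
    unfolding mult.assoc[symmetric] \<theta>(2) by (simp add: left_diff_distrib)
  also have "\<dots> \<le> real (card (A - r)) - c"
    using mult_left_mono[OF A_r c] by simp
  finally show ?thesis .
qed

lemma (in gadget) perc_prob_ge:
  assumes r: "r \<subset> V" and p: "0 < p" "p \<le> 1" and w: "0 < w" "K * card (V - r) * w \<le> n - 2"
  shows "1 - real n ^ 2 * overlap_sum V T r w p ^ K \<le> perc_prob n k EH p"
proof -
  let ?q = "random_subset p (all_edges n)" and ?o = "overlap_sum V T r w p"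
  have "1 - measure_pmf.prob ?q {G. perc_closure n k EH G = all_edges n}
      = measure_pmf.prob ?q {G. perc_closure n k EH G \<noteq> all_edges n}"
    using measure_pmf.prob_compl[of "{G. perc_closure n k EH G = all_edges n}" ?q]
    by (simp add: set_diff_eq)
  also have "\<dots> \<le> measure_pmf.prob ?q {G. \<exists>f\<in>all_edges n. f \<notin> perc_closure n k EH G}"
  proof (intro measure_pmf.finite_measure_mono_AE AE_pmfI impI)
    fix G assume G: "G \<in> set_pmf ?q" "G \<in> {G. perc_closure n k EH G \<noteq> all_edges n}"
    then have "perc_closure n k EH G \<subseteq> all_edges n"
      using set_random_subset[of p "all_edges n"] by (intro perc_closure_subset) auto
    then show "G \<in> {G. \<exists>f\<in>all_edges n. f \<notin> perc_closure n k EH G}"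
      using G(2) by blast
  qed simp
  also have "\<dots> \<le> (\<Sum>f\<in>all_edges n. measure_pmf.prob ?q {G. f \<notin> perc_closure n k EH G})"
    by (rule measure_pmf_Ex_le_sum) simp
  also have "\<dots> \<le> (\<Sum>f\<in>all_edges n. ?o ^ K)"
    by (intro sum_mono prob_not_infected_le[OF r _ p w])
  also have "\<dots> = real (n choose 2) * ?o ^ K"
    by (simp add: card_all_edges)
  also have "\<dots> \<le> real n ^ 2 * ?o ^ K"
  proof (rule mult_right_mono)
    have "n choose 2 \<le> n ^ 2"
      unfolding choose_two power2_eq_square
      by (metis div_le_dividend diff_le_self le_trans mult_le_mono2)
    then show "real (n choose 2) \<le> real n ^ 2"
      by (metis of_nat_le_iff of_nat_power)
    show "0 \<le> ?o ^ K"
      unfolding overlap_sum_def using p by (intro zero_le_power sum_nonneg) simp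
  qed
  finally show ?thesis
    using p by (simp add: gnp_prob_eq_random_subset)
qed

lemma (in gadget) eventually_perc_prob_ge:
  assumes r: "r \<subset> V" and \<theta>: "0 \<le> \<theta>" and c: "0 < c"
    and exponent: "\<And>A. r \<subset> A \<Longrightarrow> A \<subseteq> V \<Longrightarrow> \<theta> * real (card (edges_in T A)) \<le> real (card (A - r)) - c"
  shows "\<forall>\<^sub>F n in sequentially. 1 / 2 \<le> perc_prob n k EH (real n powr - \<theta>)"
proof -
  obtain K :: nat where K: "2 / c < real K"
    using reals_Archimedean2 by blast
  define m where "m = K * card (V - r)"
  have "0 < K"
    using K c by (intro Nat.gr0I) (auto simp: field_simps)
  then have m: "0 < m"
    unfolding m_def using r finite_V by (auto simp: card_gt_0_iff)
  let ?d = "\<lambda>n. overlap_sum V T r (real ((n - 2) div m)) (real n powr - \<theta>)"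
  have "?d \<in> O(\<lambda>n. real n powr - c)"
    using exponent by (intro overlap_sum_bigo inverse_nat_div_bigo m)
  then have "(\<lambda>n. real n ^ 2 * ?d n ^ K) \<longlonglongrightarrow> 0"
    using K c by (intro square_mult_power_bigo_tendsto_0[of _ c]) (auto simp: field_simps)
  then have "\<forall>\<^sub>F n in sequentially. real n ^ 2 * ?d n ^ K < 1 / 2"
    by (rule order_tendstoD) simp
  then show ?thesis
    using eventually_ge_at_top[of "m + 2"]
  proof eventually_elim
    case (elim n)
    have "0 < (n - 2) div m" "m * ((n - 2) div m) \<le> n - 2"
      using elim(2) m by (auto simp: div_greater_zero_iff)
    moreover have "real n powr - \<theta> \<le> 1"
      using elim(2) \<theta> powr_mono[of "- \<theta>" 0 "real n"] by simp
    ultimately have "1 - real n ^ 2 * ?d n ^ K \<le> perc_prob n k EH (real n powr - \<theta>)"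
      using elim(2) by (intro perc_prob_ge[OF r]) (auto simp: m_def)
    then show ?case
      using elim(1) by simp
  qed
qed

lemma (in balanced_graph) eventually_perc_prob_ge:
  assumes \<epsilon>: "0 < \<epsilon>" "\<epsilon> < 1 / \<Lambda>"
  shows "\<forall>\<^sub>F n in sequentially. 1 / 2 \<le> perc_prob n k EH (real n powr (\<epsilon> - 1 / \<Lambda>))"
proof -
  define c \<theta> where "c = \<epsilon> * \<Lambda>" and "\<theta> = 1 / \<Lambda> - \<epsilon>"
  have c: "0 < c" and \<theta>: "0 < \<theta>" "\<theta> * \<Lambda> = 1 - c"
    using \<epsilon> lambda_ge_1 unfolding c_def \<theta>_def by (auto simp: field_simps)
  obtain L :: nat where L: "(\<theta> + c) / c < real L"
    using reals_Archimedean2 by blast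
  obtain V :: "nat set" and T r where "gadget k EH V T r" and card_V: "card V = L * (k - 2) + 2"
    using gadget_exists by blast
  then interpret gad: gadget k EH V T r
    by simp
  have "L * 1 \<le> L * (k - 2)"
    using k_ge_3 by (intro mult_le_mono2) simp
  then have "L + 2 \<le> card V"
    using card_V by simp
  then have L_le: "real L \<le> real (card V) - 2"
    by linarith
  have "0 < L"
    using L c \<theta> by (intro Nat.gr0I) (auto simp: field_simps)
  then have r: "r \<subset> V"
    using \<open>L + 2 \<le> card V\<close> gad.root_subset gad.card_root by auto
  have "\<theta> + c < c * real L"
    using L c by (simp add: pos_divide_less_eq mult.commute)
  also have "\<dots> \<le> c * (real (card V) - 2)"
    using L_le c by (intro mult_left_mono) auto
  finally have "\<theta> + c \<le> c * (real (card V) - 2)"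
    by simp
  then have "\<forall>\<^sub>F n in sequentially. 1 / 2 \<le> perc_prob n k EH (real n powr - \<theta>)"
    using c \<theta> by (intro gad.eventually_perc_prob_ge[OF r _ c] gad.scaled_card_edges_in_le) auto
  then show ?thesis
    unfolding \<theta>_def by simp
qed

section \<open>Dense clusters\<close>

definition dense_in :: "'v set set \<Rightarrow> real \<Rightarrow> 'v set \<Rightarrow> 'v set set \<Rightarrow> bool" where
  "dense_in G l S E \<longleftrightarrow> E \<subseteq> edges_in G S \<and> l * (real (card S) - 2) + 1 \<le> real (card E)"

lemma dense_in_Union:
  fixes V :: "'v set" and U :: "('v set \<times> 'v set set) set"
  assumes fin: "finite G" "finite V" "finite U" "\<And>c. c \<in> U \<Longrightarrow> finite (fst c)" and l: "0 \<le> l"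
    and dense: "\<And>c. c \<in> U \<Longrightarrow> dense_in G l (fst c) (snd c)" and disj: "disjoint_family_on snd U"
    and share: "l * (real (card V) - 2) + 1 \<le> (\<Sum>c\<in>U. l * (real (card (fst c \<inter> V)) - 2) + 1)"
  shows "dense_in G l (V \<union> \<Union> (fst ` U)) (\<Union> (snd ` U))"
  unfolding dense_in_def
proof
  have sub: "snd c \<subseteq> edges_in G (fst c)" if "c \<in> U" for c
    using dense[OF that] unfolding dense_in_def by blast
  then show "\<Union> (snd ` U) \<subseteq> edges_in G (V \<union> \<Union> (fst ` U))"
    unfolding edges_in_def by blast
  let ?out = "\<Sum>c\<in>U. card (fst c - V)"
  have "card (\<Union> (snd ` U)) = (\<Sum>c\<in>U. card (snd c))"
    using fin(3) finite_subset[OF sub finite_edges_in[OF fin(1)]] disj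
    by (intro card_UN_disjoint') simp_all
  then have E: "real (card (\<Union> (snd ` U))) = (\<Sum>c\<in>U. real (card (snd c)))"
    by simp
  have "(\<Sum>c\<in>U. l * (real (card (fst c \<inter> V)) - 2) + 1) + l * real ?out
      = (\<Sum>c\<in>U. l * (real (card (fst c)) - 2) + 1)"
  proof -
    have "card (fst c) = card (fst c \<inter> V) + card (fst c - V)" if "c \<in> U" for c
      using fin(4)[OF that]
      by (metis Int_Diff_Un Int_Diff_disjoint card_Un_disjoint finite_Diff finite_Int)
    then have "(\<Sum>c\<in>U. l * (real (card (fst c)) - 2) + 1)
        = (\<Sum>c\<in>U. (l * (real (card (fst c \<inter> V)) - 2) + 1) + l * real (card (fst c - V)))"
      by (intro sum.cong refl) (simp add: algebra_simps)
    then show ?thesis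
      by (simp only: sum.distrib sum_distrib_left of_nat_sum)
  qed
  also have "\<dots> \<le> (\<Sum>c\<in>U. real (card (snd c)))"
    using dense unfolding dense_in_def by (intro sum_mono) blast
  finally have lower: "l * (real (card V) - 2) + 1 + l * real ?out \<le> real (card (\<Union> (snd ` U)))"
    using share E by simp
  have "card (V \<union> \<Union> (fst ` U)) = card (V \<union> (\<Union>c\<in>U. fst c - V))"
    by (rule arg_cong[where f = card]) blast
  also have "\<dots> \<le> card V + ?out"
    using card_Un_le[of V "\<Union>c\<in>U. fst c - V"] card_UN_le[OF fin(3), of "\<lambda>c. fst c - V"] by linarith
  finally have "l * (real (card (V \<union> \<Union> (fst ` U))) - 2) \<le> l * (real (card V) - 2 + real ?out)"
    using l by (intro mult_left_mono) linarith+
  then show "l * (real (card (V \<union> \<Union> (fst ` U))) - 2) + 1 \<le> real (card (\<Union> (snd ` U)))"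
    using lower by (simp add: distrib_left)
qed

locale cluster_cover =
  fixes n :: nat and l :: real and M :: nat and G :: "nat set set" and \<C> :: "(nat set \<times> nat set set) set"
  assumes finite_cover: "finite \<C>" and disjoint: "disjoint_family_on snd \<C>"
    and cluster_subset: "\<And>c. c \<in> \<C> \<Longrightarrow> fst c \<subseteq> {0..<n}"
    and card_cluster_le: "\<And>c. c \<in> \<C> \<Longrightarrow> card (fst c) \<le> M"
    and cluster_dense: "\<And>c. c \<in> \<C> \<Longrightarrow> dense_in G l (fst c) (snd c)"
    and covered: "\<And>e. e \<in> G \<Longrightarrow> \<exists>c\<in>\<C>. e \<subseteq> fst c"
begin

lemma finite_cluster: "c \<in> \<C> \<Longrightarrow> finite (fst c)"
  using cluster_subset by (rule finite_subset) simp_all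

lemma merge:
  assumes U: "U \<subseteq> \<C>" "2 \<le> card U"
    and S: "S \<subseteq> {0..<n}" "\<Union> (fst ` U) \<subseteq> S" "card S \<le> M" and dense: "dense_in G l S (\<Union> (snd ` U))"
  shows "\<exists>\<C>'. cluster_cover n l M G \<C>' \<and> card \<C>' < card \<C>"
proof (intro exI conjI)
  let ?\<C>' = "insert (S, \<Union> (snd ` U)) (\<C> - U)"
  have finU: "finite U"
    using U(1) finite_cover by (rule finite_subset)
  have "card ?\<C>' \<le> card (\<C> - U) + 1"
    using card_insert_le_m1[of "card (\<C> - U) + 1" "\<C> - U"] by simp
  moreover have "card (\<C> - U) = card \<C> - card U" "card U \<le> card \<C>"
    using finU U(1) finite_cover by (auto intro: card_Diff_subset card_mono)
  ultimately show "card ?\<C>' < card \<C>"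
    using U(2) by linarith
  show "cluster_cover n l M G ?\<C>'"
  proof
    have "snd c \<inter> snd d = {}" if "c \<in> \<C> - U" "d \<in> U" for c d
      using that U(1) by (intro disjoint_family_onD[OF disjoint]) auto
    then have "snd c \<inter> \<Union> (snd ` U) = {}" if "c \<in> \<C> - U" for c
      using that by (simp add: Int_UN_distrib)
    moreover have "disjoint_family_on snd (\<C> - U)"
      using disjoint by (rule disjoint_family_on_mono[rotated]) blast
    ultimately show "disjoint_family_on snd ?\<C>'"
      unfolding disjoint_family_on_def by (simp add: Int_commute)
    show "fst c \<subseteq> {0..<n}" "card (fst c) \<le> M" "dense_in G l (fst c) (snd c)" if "c \<in> ?\<C>'" for c
      using that cluster_subset[of c] card_cluster_le[of c] cluster_dense[of c] S(1,3) dense by auto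
    show "\<exists>c\<in>?\<C>'. e \<subseteq> fst c" if e: "e \<in> G" for e
    proof -
      obtain c where "c \<in> \<C>" "e \<subseteq> fst c"
        using covered[OF e] by blast
      then show ?thesis
        using S(2) by (cases "c \<in> U") force+
    qed
  qed (use finite_cover in simp)
qed

end

lemma cluster_cover_singletons:
  assumes G: "G \<subseteq> all_edges n" and M: "2 \<le> M"
  shows "cluster_cover n l M G ((\<lambda>e. (e, {e})) ` G)"
proof
  fix c assume "c \<in> (\<lambda>e. (e, {e})) ` G"
  then obtain e where "e \<in> G" "c = (e, {e})"
    by blast
  then show "fst c \<subseteq> {0..<n}" "card (fst c) \<le> M" "dense_in G l (fst c) (snd c)"
    using G M unfolding dense_in_def edges_in_def all_edges_altdef by auto
qed (use finite_subset[OF G] in \<open>auto simp: disjoint_family_on_def\<close>)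

context balanced_graph
begin

lemma edges_cover_share:
  assumes x0: "x0 \<in> EH" and U: "finite U" and F: "\<And>c. c \<in> U \<Longrightarrow> F c \<subset> {0..<k}" "\<And>c. c \<in> U \<Longrightarrow> 2 \<le> card (F c)"
    and cover: "EH - {x0} \<subseteq> (\<Union>c\<in>U. edges_in EH (F c))"
  shows "\<Lambda> * (real k - 2) + 1 \<le> (\<Sum>c\<in>U. \<Lambda> * (real (card (F c)) - 2) + 1)" "2 \<le> card U"
proof -
  have "card (EH - {x0}) \<le> card (\<Union>c\<in>U. edges_in EH (F c))"
    using U finite_edges_in[OF finite_edges] cover by (intro card_mono) auto
  also have "\<dots> \<le> (\<Sum>c\<in>U. card (edges_in EH (F c)))"
    by (rule card_UN_le[OF U])
  finally have "real (card (EH - {x0})) \<le> (\<Sum>c\<in>U. real (card (edges_in EH (F c))))"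
    by (simp only: of_nat_le_iff flip: of_nat_sum)
  also have "\<dots> \<le> (\<Sum>c\<in>U. \<Lambda> * (real (card (F c)) - 2) + 1)"
    by (intro sum_mono card_edges_in_le F)
  also have "real (card (EH - {x0})) = \<Lambda> * (real k - 2) + 1"
    using x0 card_edges card_edges_ge_3 finite_edges by (simp add: of_nat_diff)
  finally show share: "\<Lambda> * (real k - 2) + 1 \<le> (\<Sum>c\<in>U. \<Lambda> * (real (card (F c)) - 2) + 1)" .
  show "2 \<le> card U"
  proof (rule ccontr)
    assume "\<not> 2 \<le> card U"
    moreover have "U \<noteq> {}"
      using share card_edges card_edges_ge_3 by auto
    ultimately have "card U = 1"
      using U by (simp add: card_gt_0_iff le_Suc_eq not_le numeral_2_eq_2 less_Suc_eq_le)
    then obtain c where c: "U = {c}"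
      by (rule card_1_singletonE)
    then have "card (F c) < k"
      using psubset_card_mono[OF _ F(1)[of c]] by simp
    then have "\<Lambda> * (real (card (F c)) - 2) < \<Lambda> * (real k - 2)"
      using lambda_ge_1 by simp
    then show False
      using share c by simp
  qed
qed

lemma copy_cover_share:
  fixes S :: "'c \<Rightarrow> 'v set"
  assumes f: "inj_on f {0..<k}" and x0: "x0 \<in> EH"
    and copy: "\<And>x. x \<in> EH - {x0} \<Longrightarrow> \<exists>c\<in>\<C>. f ` x \<subseteq> S c" and new: "\<And>c. c \<in> \<C> \<Longrightarrow> \<not> f ` x0 \<subseteq> S c"
  obtains U where "U \<subseteq> \<C>" "finite U" "2 \<le> card U" "card U \<le> card EH"
    "\<Lambda> * (real k - 2) + 1 \<le> (\<Sum>c\<in>U. \<Lambda> * (real (card (S c \<inter> f ` {0..<k})) - 2) + 1)"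
proof -
  obtain cl where cl: "\<And>x. x \<in> EH - {x0} \<Longrightarrow> cl x \<in> \<C>" "\<And>x. x \<in> EH - {x0} \<Longrightarrow> f ` x \<subseteq> S (cl x)"
    using copy by metis
  define U where "U = cl ` (EH - {x0})"
  have U: "U \<subseteq> \<C>" "finite U"
    unfolding U_def using finite_edges cl(1) by blast+
  define F where "F c = {i \<in> {0..<k}. f i \<in> S c}" for c
  have F_psubset: "F c \<subset> {0..<k}" if "c \<in> U" for c
    using new[of c] edgeD(1)[OF x0] U(1) that unfolding F_def by blast
  have in_F: "x \<subseteq> F (cl x)" if "x \<in> EH - {x0}" for x
    using cl(2)[OF that] edgeD(1)[of x] that unfolding F_def by blast
  have card_F_ge: "2 \<le> card (F c)" if c: "c \<in> U" for c
  proof -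
    obtain x where x: "x \<in> EH - {x0}" "c = cl x"
      using c unfolding U_def by blast
    then have "card x \<le> card (F c)"
      using in_F[OF x(1)] by (intro card_mono) (auto simp: F_def)
    then show ?thesis
      using edgeD(2)[of x] x(1) by simp
  qed
  have "EH - {x0} \<subseteq> (\<Union>c\<in>U. edges_in EH (F c))"
    using in_F unfolding U_def edges_in_def by blast
  note share = edges_cover_share[OF x0 U(2) F_psubset card_F_ge this]
  have card_F: "card (S c \<inter> f ` {0..<k}) = card (F c)" for c
  proof -
    have "S c \<inter> f ` {0..<k} = f ` F c" "F c \<subseteq> {0..<k}"
      unfolding F_def by blast+
    then show ?thesis
      by (simp add: card_image[OF inj_on_subset[OF f]])
  qed
  have "card U \<le> card EH"
    using finite_edges card_image_le[of "EH - {x0}" cl] card_mono[of EH "EH - {x0}"]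
    unfolding U_def by auto
  then show thesis
    using U share by (intro that) (simp_all add: card_F)
qed

lemma cluster_cover_absorb_copy:
  assumes "cluster_cover n \<Lambda> M G \<C>" and G: "finite G"
    and f: "inj_on f {0..<k}" "f ` {0..<k} \<subseteq> {0..<n}" and x0: "x0 \<in> EH"
    and copy: "\<And>x. x \<in> EH - {x0} \<Longrightarrow> \<exists>c\<in>\<C>. f ` x \<subseteq> fst c" and new: "\<And>c. c \<in> \<C> \<Longrightarrow> \<not> f ` x0 \<subseteq> fst c"
    and gap: "\<And>S E. S \<subseteq> {0..<n} \<Longrightarrow> M < card S \<Longrightarrow> card S \<le> k + card EH * M \<Longrightarrow> \<not> dense_in G \<Lambda> S E"
  shows "\<exists>\<C>'. cluster_cover n \<Lambda> M G \<C>' \<and> card \<C>' < card \<C>"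
proof -
  interpret cluster_cover n \<Lambda> M G \<C>
    by fact
  let ?V = "f ` {0..<k}"
  obtain U where U: "U \<subseteq> \<C>" "finite U" "2 \<le> card U" "card U \<le> card EH"
    and share: "\<Lambda> * (real k - 2) + 1 \<le> (\<Sum>c\<in>U. \<Lambda> * (real (card (fst c \<inter> ?V)) - 2) + 1)"
    by (rule copy_cover_share[OF f(1) x0 copy new])
  have card_V: "card ?V = k"
    using f(1) by (simp add: card_image)
  let ?S = "?V \<union> \<Union> (fst ` U)"
  have dense: "dense_in G \<Lambda> ?S (\<Union> (snd ` U))"
  proof (rule dense_in_Union)
    show "disjoint_family_on snd U"
      using disjoint U(1) by (rule disjoint_family_on_mono[rotated])
  qed (use G U(1,2) cluster_dense finite_cluster card_V share lambda_ge_1 in auto)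
  have S_n: "?S \<subseteq> {0..<n}"
    using f(2) cluster_subset U(1) by blast
  have "card ?S \<le> card ?V + (\<Sum>c\<in>U. card (fst c))"
    using card_Un_le[of ?V "\<Union> (fst ` U)"] card_UN_le[OF U(2), of fst] by linarith
  also have "(\<Sum>c\<in>U. card (fst c)) \<le> card U * M"
    using sum_bounded_above[of U "\<lambda>c. card (fst c)" M] card_cluster_le U(1) by auto
  also have "\<dots> \<le> card EH * M"
    using U(4) by (rule mult_le_mono1)
  finally have "card ?S \<le> k + card EH * M"
    using card_V by simp
  then have "card ?S \<le> M"
    using gap[OF S_n] dense not_le by blast
  then show ?thesis
    by (intro merge[OF U(1,3) S_n _ _ dense]) auto
qed

lemma minimal_cluster_cover_closed:
  assumes \<C>: "cluster_cover n \<Lambda> M G \<C>" and least: "\<And>\<C>'. cluster_cover n \<Lambda> M G \<C>' \<Longrightarrow> card \<C> \<le> card \<C>'"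
    and G: "finite G"
    and gap: "\<And>S E. S \<subseteq> {0..<n} \<Longrightarrow> M < card S \<Longrightarrow> card S \<le> k + card EH * M \<Longrightarrow> \<not> dense_in G \<Lambda> S E"
    and copy: "has_copy_containing n k EH (X \<union> {e}) e" and X: "\<And>x. x \<in> X \<Longrightarrow> \<exists>c\<in>\<C>. x \<subseteq> fst c"
  shows "\<exists>c\<in>\<C>. e \<subseteq> fst c"
proof (rule ccontr)
  assume new: "\<not> (\<exists>c\<in>\<C>. e \<subseteq> fst c)"
  obtain f x0 where f: "inj_on f {0..<k}" "f ` {0..<k} \<subseteq> {0..<n}"
    and in_X: "\<forall>x\<in>EH. f ` x \<in> X \<union> {e}" and x0: "x0 \<in> EH" "e = f ` x0"
    using copy unfolding has_copy_containing_def by blast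
  have covered: "\<exists>c\<in>\<C>. f ` x \<subseteq> fst c" if x: "x \<in> EH - {x0}" for x
  proof -
    have "f ` x \<noteq> e"
      using x x0 inj_on_image_eq_iff[OF f(1)] edgeD(1) by auto
    then show ?thesis
      using in_X x by (intro X) auto
  qed
  obtain \<C>' where "cluster_cover n \<Lambda> M G \<C>'" "card \<C>' < card \<C>"
    using cluster_cover_absorb_copy[OF \<C> G f x0(1) covered _ gap] new x0(2) by blast
  then show False
    using least[of \<C>'] by simp
qed

lemma perc_closure_dense:
  assumes G: "G \<subseteq> all_edges n" and M: "2 \<le> M"
    and gap: "\<And>S E. S \<subseteq> {0..<n} \<Longrightarrow> M < card S \<Longrightarrow> card S \<le> k + card EH * M \<Longrightarrow> \<not> dense_in G \<Lambda> S E"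
    and e: "e \<in> perc_closure n k EH G"
  shows "\<exists>S E. S \<subseteq> {0..<n} \<and> e \<subseteq> S \<and> card S \<le> M \<and> dense_in G \<Lambda> S E"
proof -
  obtain \<C> where \<C>: "cluster_cover n \<Lambda> M G \<C>"
    and least: "\<And>\<C>'. cluster_cover n \<Lambda> M G \<C>' \<Longrightarrow> card \<C> \<le> card \<C>'"
    using ex_has_least_nat[of "cluster_cover n \<Lambda> M G" _ card] cluster_cover_singletons[OF G M] by blast
  interpret cluster_cover n \<Lambda> M G \<C>
    by fact
  have "perc_closure n k EH G \<subseteq> {e. \<exists>c\<in>\<C>. e \<subseteq> fst c}"
  proof (rule perc_closure_least)
    show "G \<subseteq> {e. \<exists>c\<in>\<C>. e \<subseteq> fst c}"
      using covered by blast
    show "e \<in> {e. \<exists>c\<in>\<C>. e \<subseteq> fst c}"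
      if "has_copy_containing n k EH ({e. \<exists>c\<in>\<C>. e \<subseteq> fst c} \<union> {e}) e" for e
      using minimal_cluster_cover_closed[OF \<C> least finite_subset[OF G finite_all_edges] gap that]
      by simp
  qed
  then obtain c where c: "c \<in> \<C>" "e \<subseteq> fst c"
    using e by blast
  then show ?thesis
    using cluster_subset[OF c(1)] card_cluster_le[OF c(1)] cluster_dense[OF c(1)] by blast
qed

end

section \<open>No percolation below the threshold\<close>

lemma card_supersets_of_card_le:
  assumes "finite X" "R \<subseteq> X"
  shows "card {S. R \<subseteq> S \<and> S \<subseteq> X \<and> card S = s} \<le> card X ^ (s - card R)"
proof -
  have "card {S. R \<subseteq> S \<and> S \<subseteq> X \<and> card S = s} \<le> card {S. S \<subseteq> X \<and> card S = s - card R}"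
  proof (rule card_inj_on_le)
    show "inj_on (\<lambda>S. S - R) {S. R \<subseteq> S \<and> S \<subseteq> X \<and> card S = s}"
      by (rule inj_on_inverseI[where g = "\<lambda>S. S \<union> R"]) auto
    show "(\<lambda>S. S - R) ` {S. R \<subseteq> S \<and> S \<subseteq> X \<and> card S = s} \<subseteq> {S. S \<subseteq> X \<and> card S = s - card R}"
      using assms finite_subset[OF assms(2,1)] by (auto simp: card_Diff_subset)
  qed (use assms in simp)
  also have "\<dots> = card X choose (s - card R)"
    using assms(1) by (rule n_subsets)
  also have "\<dots> \<le> card X ^ (s - card R)"
    by (cases "s - card R \<le> card X") (auto simp: binomial_le_pow binomial_eq_0)
  finally show ?thesis .
qed

lemma prob_random_subset_Ex_supset_le:
  assumes E: "finite E" and Q: "Q \<subseteq> Pow E" and m: "\<And>D. D \<in> Q \<Longrightarrow> m \<le> real (card D)" and p: "0 < p" "p \<le> 1"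
  shows "measure_pmf.prob (random_subset p E) {G. \<exists>D\<in>Q. D \<subseteq> G} \<le> real (card Q) * p powr m"
proof -
  have "finite Q"
    using Q E by (simp add: finite_subset)
  then have "measure_pmf.prob (random_subset p E) {G. \<exists>D\<in>Q. D \<subseteq> G}
      \<le> (\<Sum>D\<in>Q. measure_pmf.prob (random_subset p E) {G. D \<subseteq> G})"
    by (rule measure_pmf_Ex_le_sum)
  also have "\<dots> = (\<Sum>D\<in>Q. p powr real (card D))"
    using Q E p by (intro sum.cong refl) (auto simp: prob_random_subset_supset powr_realpow)
  also have "\<dots> \<le> (\<Sum>D\<in>Q. p powr m)"
    using m p by (intro sum_mono powr_mono') auto
  finally show ?thesis by simp
qed

lemma prob_dense_in_le:
  assumes E: "finite E" and S: "finite S" and p: "0 < p" "p \<le> 1"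
  shows "measure_pmf.prob (random_subset p E) {G. \<exists>D. dense_in G l S D}
    \<le> 2 ^ (2 ^ card S) * p powr (l * (real (card S) - 2) + 1)"
proof -
  let ?m = "l * (real (card S) - 2) + 1"
  define Q where "Q = {D. D \<subseteq> edges_in E S \<and> ?m \<le> real (card D)}"
  have "measure_pmf.prob (random_subset p E) {G. \<exists>D. dense_in G l S D}
      \<le> measure_pmf.prob (random_subset p E) {G. \<exists>D\<in>Q. D \<subseteq> G}"
  proof (intro measure_pmf.finite_measure_mono_AE AE_pmfI impI)
    fix G assume "G \<in> set_pmf (random_subset p E)" "G \<in> {G. \<exists>D. dense_in G l S D}"
    then obtain D where "G \<subseteq> E" "dense_in G l S D"
      using set_random_subset[of p E] by auto
    then have "D \<in> Q" "D \<subseteq> G"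
      unfolding Q_def dense_in_def edges_in_def by auto
    then show "G \<in> {G. \<exists>D\<in>Q. D \<subseteq> G}"
      by blast
  qed simp
  also have "\<dots> \<le> real (card Q) * p powr ?m"
    using E p by (intro prob_random_subset_Ex_supset_le) (auto simp: Q_def edges_in_def)
  also have "\<dots> \<le> 2 ^ (2 ^ card S) * p powr ?m"
  proof (rule mult_right_mono)
    have "Q \<subseteq> Pow (Pow S)"
      unfolding Q_def edges_in_def by blast
    then have "card Q \<le> 2 ^ (2 ^ card S)"
      using card_mono[of "Pow (Pow S)" Q] S by (simp add: card_Pow)
    then show "real (card Q) \<le> 2 ^ (2 ^ card S)"
      by (simp flip: of_nat_le_iff)
  qed simp
  finally show ?thesis .
qed

text \<open>Number of sets of size $s$ containing a fixed set of size $r$, times number of edge sets on such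
  a set, times probability of a sufficiently large edge set.\<close>

definition dense_superset_bound :: "real \<Rightarrow> nat \<Rightarrow> nat set \<Rightarrow> nat \<Rightarrow> real \<Rightarrow> real" where
  "dense_superset_bound l r I n p =
    (\<Sum>s\<in>I. real n ^ (s - r) * (2 ^ (2 ^ s) * p powr (l * (real s - 2) + 1)))"

lemma prob_ex_dense_superset_le:
  assumes R: "R \<subseteq> {0..<n}" and I: "finite I" and p: "0 < p" "p \<le> 1"
  shows "measure_pmf.prob (random_subset p (all_edges n))
      {G. \<exists>S D. R \<subseteq> S \<and> S \<subseteq> {0..<n} \<and> card S \<in> I \<and> dense_in G l S D}
    \<le> dense_superset_bound l (card R) I n p"
proof -
  let ?q = "random_subset p (all_edges n)" and ?b = "\<lambda>s. 2 ^ (2 ^ s) * p powr (l * (real s - 2) + 1)"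
  define Q where "Q s = {S. R \<subseteq> S \<and> S \<subseteq> {0..<n} \<and> card S = s}" for s
  have finQ: "finite (Q s)" for s
    unfolding Q_def by (rule finite_subset[of _ "Pow {0..<n}"]) auto
  have "measure_pmf.prob ?q {G. \<exists>S D. R \<subseteq> S \<and> S \<subseteq> {0..<n} \<and> card S \<in> I \<and> dense_in G l S D}
      = measure_pmf.prob ?q {G. \<exists>s\<in>I. \<exists>S\<in>Q s. \<exists>D. dense_in G l S D}"
    unfolding Q_def by (rule arg_cong[where f = "measure_pmf.prob ?q"]) blast
  also have "\<dots> \<le> (\<Sum>s\<in>I. measure_pmf.prob ?q {G. \<exists>S\<in>Q s. \<exists>D. dense_in G l S D})"
    by (rule measure_pmf_Ex_le_sum[OF I])
  also have "\<dots> \<le> (\<Sum>s\<in>I. real n ^ (s - card R) * ?b s)"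
  proof (rule sum_mono)
    fix s
    have "measure_pmf.prob ?q {G. \<exists>S\<in>Q s. \<exists>D. dense_in G l S D}
        \<le> (\<Sum>S\<in>Q s. measure_pmf.prob ?q {G. \<exists>D. dense_in G l S D})"
      by (rule measure_pmf_Ex_le_sum[OF finQ])
    also have "\<dots> \<le> (\<Sum>S\<in>Q s. ?b s)"
    proof (rule sum_mono)
      fix S assume "S \<in> Q s"
      then have "finite S" "card S = s"
        unfolding Q_def using finite_subset by auto
      then show "measure_pmf.prob ?q {G. \<exists>D. dense_in G l S D} \<le> ?b s"
        using prob_dense_in_le[OF finite_all_edges _ p, of S n l] by simp
    qed
    also have "\<dots> \<le> real n ^ (s - card R) * ?b s"
      using card_supersets_of_card_le[of "{0..<n}" R s] R unfolding Q_def
      by (simp add: mult_right_mono flip: of_nat_power)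
    finally show "measure_pmf.prob ?q {G. \<exists>S\<in>Q s. \<exists>D. dense_in G l S D} \<le> real n ^ (s - card R) * ?b s" .
  qed
  finally show ?thesis
    unfolding dense_superset_bound_def .
qed

lemma dense_superset_bound_mono:
  assumes "0 < p" "p \<le> p'" "0 \<le> l" "\<And>s. s \<in> I \<Longrightarrow> 2 \<le> s"
  shows "dense_superset_bound l r I n p \<le> dense_superset_bound l r I n p'"
  unfolding dense_superset_bound_def using assms
  by (intro sum_mono mult_left_mono powr_mono2) (auto intro!: add_nonneg_nonneg mult_nonneg_nonneg)

lemma dense_superset_bound_tendsto_0:
  assumes l: "0 < l" and I: "\<And>s. s \<in> I \<Longrightarrow> r \<le> s"
    "\<And>s. s \<in> I \<Longrightarrow> 2 - real r < \<epsilon> * (l * (real s - 2) + 1) + 1 / l"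
  shows "(\<lambda>n. dense_superset_bound l r I n (real n powr (- \<epsilon> - 1 / l))) \<longlonglongrightarrow> 0"
  unfolding dense_superset_bound_def
proof (rule tendsto_null_sum)
  fix s assume s: "s \<in> I"
  let ?m = "l * (real s - 2) + 1"
  let ?e = "(real s - real r) + (- \<epsilon> - 1 / l) * ?m"
  have "?e = (2 - real r) - (\<epsilon> * ?m + 1 / l)"
    using l by (simp add: field_simps)
  then have "?e < 0"
    using I(2)[OF s] by linarith
  then have "(\<lambda>n. real n powr ?e) \<longlonglongrightarrow> 0"
    by (rule tendsto_neg_powr) (rule filterlim_real_sequentially)
  then have "(\<lambda>n. 2 ^ (2 ^ s) * real n powr ?e) \<longlonglongrightarrow> 0"
    by (rule tendsto_mult_right_zero)
  moreover have "\<forall>\<^sub>F n in sequentially. 2 ^ (2 ^ s) * real n powr ?e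
      = real n ^ (s - r) * (2 ^ (2 ^ s) * (real n powr (- \<epsilon> - 1 / l)) powr ?m)"
    using eventually_gt_at_top[of 0]
  proof eventually_elim
    case (elim n)
    then have "real n ^ (s - r) = real n powr (real s - real r)"
      using I(1)[OF s] by (simp add: of_nat_diff flip: powr_realpow)
    then show ?case
      by (simp only: powr_add[of _ "real s - real r"] powr_powr mult.left_commute)
  qed
  ultimately show "(\<lambda>n. real n ^ (s - r) * (2 ^ (2 ^ s) * (real n powr (- \<epsilon> - 1 / l)) powr ?m)) \<longlonglongrightarrow> 0"
    by (rule Lim_transform_eventually)
qed

lemma dense_superset_bounds_tendsto_0:
  assumes \<epsilon>: "0 < \<epsilon>" and l: "0 < l"
  obtains M where "2 \<le> M" "\<And>J :: nat set. J \<subseteq> {M<..} \<Longrightarrow>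
    (\<lambda>n. dense_superset_bound l 0 J n (real n powr (- \<epsilon> - 1 / l))
      + dense_superset_bound l 2 {2..M} n (real n powr (- \<epsilon> - 1 / l))) \<longlonglongrightarrow> 0"
proof -
  obtain M0 :: nat where M0: "2 / (\<epsilon> * l) < real M0"
    using reals_Archimedean2 by blast
  have exponent: "\<epsilon> * (l * (real s - 2) + 1) = \<epsilon> * l * (real s - 2) + \<epsilon>" for s
    by (simp add: distrib_left)
  have inv_l: "0 < 1 / l"
    using l by simp
  have "(\<lambda>n. dense_superset_bound l 0 J n (real n powr (- \<epsilon> - 1 / l))
      + dense_superset_bound l 2 {2..M0 + 2} n (real n powr (- \<epsilon> - 1 / l))) \<longlonglongrightarrow> 0 + 0"
    if J: "J \<subseteq> {M0 + 2<..}" for J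
  proof (intro tendsto_add dense_superset_bound_tendsto_0 l)
    show "2 - real 0 < \<epsilon> * (l * (real s - 2) + 1) + 1 / l" if "s \<in> J" for s
    proof -
      have "2 / (\<epsilon> * l) \<le> real s - 2"
        using M0 J that by auto
      then have "2 \<le> \<epsilon> * l * (real s - 2)"
        using \<epsilon> l by (simp add: pos_divide_le_eq mult.commute)
      then show ?thesis
        unfolding exponent using \<epsilon> inv_l by linarith
    qed
    show "2 - real 2 < \<epsilon> * (l * (real s - 2) + 1) + 1 / l" if "s \<in> {2..M0 + 2}" for s
    proof -
      have "0 \<le> \<epsilon> * l * (real s - 2)"
        using that \<epsilon> l by simp
      then have "0 < \<epsilon> * l * (real s - 2) + \<epsilon> + 1 / l"
        using \<epsilon> inv_l by linarith
      then show ?thesis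
        unfolding exponent by simp
    qed
  qed auto
  then show thesis
    by (intro that[of "M0 + 2"]) simp_all
qed

context balanced_graph
begin

lemma percolates_imp_dense:
  assumes n: "2 \<le> n" and M: "2 \<le> M" and G: "G \<subseteq> all_edges n" "perc_closure n k EH G = all_edges n"
  obtains S D where "S \<subseteq> {0..<n}" "dense_in G \<Lambda> S D" "M < card S" "card S \<le> k + card EH * M"
    | S D where "S \<subseteq> {0..<n}" "dense_in G \<Lambda> S D" "{0, 1} \<subseteq> S" "2 \<le> card S" "card S \<le> M"
proof (cases "\<exists>S D. S \<subseteq> {0..<n} \<and> M < card S \<and> card S \<le> k + card EH * M \<and> dense_in G \<Lambda> S D")
  case True
  then show thesis
    using that(1) by blast
next
  case False
  have "{0, 1} \<in> perc_closure n k EH G"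
    using G(2) n unfolding all_edges_def by force
  then have "\<exists>S D. S \<subseteq> {0..<n} \<and> {0, 1} \<subseteq> S \<and> card S \<le> M \<and> dense_in G \<Lambda> S D"
    by (rule perc_closure_dense[OF G(1) M, rotated]) (use False in auto)
  then obtain S D where S: "S \<subseteq> {0..<n}" "{0, 1} \<subseteq> S" "card S \<le> M" "dense_in G \<Lambda> S D"
    by auto
  have "card {0, 1 :: nat} \<le> card S"
    using S(2) finite_subset[OF S(1)] by (intro card_mono) auto
  then show thesis
    using that(2) S by simp
qed

lemma perc_prob_le:
  assumes n: "2 \<le> n" and M: "2 \<le> M" and p: "0 < p" "p \<le> 1"
  shows "perc_prob n k EH p
    \<le> dense_superset_bound \<Lambda> 0 {M<..k + card EH * M} n p + dense_superset_bound \<Lambda> 2 {2..M} n p"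
proof -
  let ?q = "random_subset p (all_edges n)"
  let ?dense = "\<lambda>R I. {G. \<exists>S D. R \<subseteq> S \<and> S \<subseteq> {0..<n} \<and> card S \<in> I \<and> dense_in G \<Lambda> S D}"
  let ?J = "{M<..k + card EH * M}"
  have "perc_prob n k EH p
      = measure_pmf.prob ?q {G. perc_closure n k EH G = all_edges n}"
    using p by (simp add: gnp_prob_eq_random_subset)
  also have "\<dots> \<le> measure_pmf.prob ?q (?dense {} ?J \<union> ?dense {0, 1} {2..M})"
  proof (intro measure_pmf.finite_measure_mono_AE AE_pmfI impI)
    fix G assume "G \<in> set_pmf ?q" "G \<in> {G. perc_closure n k EH G = all_edges n}"
    then have G: "G \<subseteq> all_edges n" "perc_closure n k EH G = all_edges n"
      using set_random_subset[of p "all_edges n"] by auto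
    show "G \<in> ?dense {} ?J \<union> ?dense {0, 1} {2..M}"
    proof (cases rule: percolates_imp_dense[OF n M G])
      case (1 S D)
      then have "G \<in> ?dense {} ?J"
        by (intro CollectI exI[of _ S] exI[of _ D]) simp
      then show ?thesis ..
    next
      case (2 S D)
      then have "G \<in> ?dense {0, 1} {2..M}"
        by (intro CollectI exI[of _ S] exI[of _ D]) simp
      then show ?thesis ..
    qed
  qed simp
  also have "\<dots> \<le> measure_pmf.prob ?q (?dense {} ?J) + measure_pmf.prob ?q (?dense {0, 1} {2..M})"
    by (intro measure_Un_le) auto
  also have "\<dots> \<le> dense_superset_bound \<Lambda> 0 ?J n p + dense_superset_bound \<Lambda> 2 {2..M} n p"
    using prob_ex_dense_superset_le[of "{}" n ?J p \<Lambda>]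
      prob_ex_dense_superset_le[of "{0, 1}" n "{2..M}" p \<Lambda>] n p
    by (intro add_mono) (simp_all add: numeral_2_eq_2)
  finally show ?thesis .
qed

lemma eventually_perc_prob_less:
  assumes \<epsilon>: "0 < \<epsilon>"
  shows "\<forall>\<^sub>F n in sequentially. \<forall>p. 0 < p \<longrightarrow> p \<le> real n powr (- \<epsilon> - 1 / \<Lambda>) \<longrightarrow>
    perc_prob n k EH p < 1 / 2"
proof -
  let ?p = "\<lambda>n. real n powr (- \<epsilon> - 1 / \<Lambda>)"
  have \<Lambda>: "0 < \<Lambda>" "0 < 1 / \<Lambda>"
    using lambda_ge_1 by auto
  obtain M where M: "2 \<le> M" and lim: "\<And>J :: nat set. J \<subseteq> {M<..} \<Longrightarrow>
      (\<lambda>n. dense_superset_bound \<Lambda> 0 J n (?p n) + dense_superset_bound \<Lambda> 2 {2..M} n (?p n)) \<longlonglongrightarrow> 0"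
    by (rule dense_superset_bounds_tendsto_0[OF \<epsilon> \<Lambda>(1)]) (rule that)
  let ?b = "\<lambda>n p. dense_superset_bound \<Lambda> 0 {M<..k + card EH * M} n p
      + dense_superset_bound \<Lambda> 2 {2..M} n p"
  have "(\<lambda>n. ?b n (?p n)) \<longlonglongrightarrow> 0"
    by (rule lim) auto
  then have "\<forall>\<^sub>F n in sequentially. ?b n (?p n) < 1 / 2"
    by (rule order_tendstoD) simp
  then show ?thesis
    using eventually_ge_at_top[of 2]
  proof eventually_elim
    case (elim n)
    show ?case
    proof (intro allI impI)
      fix p assume p: "0 < p" "p \<le> ?p n"
      have "?p n \<le> real n powr 0"
        using elim(2) \<epsilon> \<Lambda>(2) by (intro powr_mono) linarith+
      then have "p \<le> 1"
        using p(2) elim(2) by simp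
      then have "perc_prob n k EH p \<le> ?b n p"
        by (rule perc_prob_le[OF elim(2) M p(1)])
      also have "\<dots> \<le> ?b n (?p n)"
        using p \<Lambda>(1) M by (intro add_mono dense_superset_bound_mono) auto
      finally show "perc_prob n k EH p < 1 / 2"
        using elim(1) by simp
    qed
  qed
qed

end

section \<open>The critical exponent of a balanced graph\<close>

lemma neg_ln_over_ln_tendstoI:
  fixes x :: "nat \<Rightarrow> real"
  assumes a: "0 < a"
    and lower: "\<And>\<epsilon>. 0 < \<epsilon> \<Longrightarrow> \<forall>\<^sub>F n in sequentially. real n powr (- \<epsilon> - a) \<le> x n"
    and upper: "\<And>\<epsilon>. 0 < \<epsilon> \<Longrightarrow> \<epsilon> < a \<Longrightarrow> \<forall>\<^sub>F n in sequentially. x n \<le> real n powr (\<epsilon> - a)"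
  shows "(\<lambda>n. - ln (x n) / ln (real n)) \<longlonglongrightarrow> a"
proof (rule tendstoI)
  fix d :: real assume d: "0 < d"
  define \<epsilon> where "\<epsilon> = min d a / 2"
  have \<epsilon>: "0 < \<epsilon>" "\<epsilon> < d" "\<epsilon> < a"
    unfolding \<epsilon>_def using a d by (auto simp: min_def)
  show "\<forall>\<^sub>F n in sequentially. dist (- ln (x n) / ln (real n)) a < d"
    using lower[OF \<epsilon>(1)] upper[OF \<epsilon>(1,3)] eventually_ge_at_top[of 2]
  proof eventually_elim
    case (elim n)
    have "0 < real n powr (- \<epsilon> - a)"
      using elim(3) by simp
    then have "0 < x n"
      using elim(1) by linarith
    then have "(- \<epsilon> - a) * ln (real n) \<le> ln (x n)" "ln (x n) \<le> (\<epsilon> - a) * ln (real n)"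
      using elim ln_mono[OF elim(1)] ln_mono[OF elim(2)] by (simp_all add: ln_powr)
    then have "- \<epsilon> - a \<le> ln (x n) / ln (real n)" "ln (x n) / ln (real n) \<le> \<epsilon> - a"
      using elim(3) by (simp_all add: pos_le_divide_eq pos_divide_le_eq)
    then show ?case
      using \<epsilon>(2) by (auto simp: dist_real_def abs_less_iff)
  qed
qed

lemma p_crit_le:
  assumes "0 < p" "p \<le> 1" "1 / 2 \<le> perc_prob n k EH p"
  shows "p_crit n k EH \<le> p"
  unfolding p_crit_def using assms by (intro cInf_lower bdd_belowI[of _ 0]) auto

lemma le_p_crit:
  assumes "0 < p" "p \<le> 1" "1 / 2 \<le> perc_prob n k EH p"
    and "\<And>p. 0 < p \<Longrightarrow> p \<le> q \<Longrightarrow> perc_prob n k EH p < 1 / 2"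
  shows "q \<le> p_crit n k EH"
  unfolding p_crit_def
proof (rule cInf_greatest)
  fix p' assume "p' \<in> {p. 0 < p \<and> p \<le> 1 \<and> 1 / 2 \<le> perc_prob n k EH p}"
  then show "q \<le> p'"
    using assms(4)[of p'] by force
qed (use assms(1-3) in blast)

theorem (in balanced_graph) p_crit_exponent:
  "(\<lambda>n. - ln (p_crit n k EH) / ln (real n)) \<longlonglongrightarrow> 1 / \<Lambda>"
proof (rule neg_ln_over_ln_tendstoI)
  show pos: "0 < 1 / \<Lambda>"
    using lambda_ge_1 by simp
  have percolates: "\<forall>\<^sub>F n in sequentially. 0 < real n powr (\<epsilon> - 1 / \<Lambda>) \<and> real n powr (\<epsilon> - 1 / \<Lambda>) \<le> 1 \<and>
      1 / 2 \<le> perc_prob n k EH (real n powr (\<epsilon> - 1 / \<Lambda>))"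
    if \<epsilon>: "0 < \<epsilon>" "\<epsilon> < 1 / \<Lambda>" for \<epsilon>
    using eventually_perc_prob_ge[OF \<epsilon>] eventually_ge_at_top[of 2]
  proof eventually_elim
    case (elim n)
    then show ?case
      using \<epsilon> powr_mono[of "\<epsilon> - 1 / \<Lambda>" 0 "real n"] by simp
  qed
  show "\<forall>\<^sub>F n in sequentially. p_crit n k EH \<le> real n powr (\<epsilon> - 1 / \<Lambda>)" if "0 < \<epsilon>" "\<epsilon> < 1 / \<Lambda>" for \<epsilon>
    using percolates[OF that] by eventually_elim (simp add: p_crit_le)
  show "\<forall>\<^sub>F n in sequentially. real n powr (- \<epsilon> - 1 / \<Lambda>) \<le> p_crit n k EH" if "0 < \<epsilon>" for \<epsilon>
  proof -
    obtain \<epsilon>' where "0 < \<epsilon>'" "\<epsilon>' < 1 / \<Lambda>"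
      using dense[OF pos] by blast
    from percolates[OF this] eventually_perc_prob_less[OF that] show ?thesis
      by eventually_elim (blast intro: le_p_crit)
  qed
qed

section \<open>Random graphs are balanced\<close>

definition nbhd :: "'v set set \<Rightarrow> 'v \<Rightarrow> 'v set" where
  "nbhd EH v = {x. {v, x} \<in> EH}"

definition edge_pairs :: "'v set set \<Rightarrow> 'v set \<Rightarrow> 'v set \<Rightarrow> ('v \<times> 'v) set" where
  "edge_pairs EH A B = (SIGMA u:A. nbhd EH u \<inter> B)"

lemma card_edge_pairs:
  assumes "finite A" "finite B"
  shows "card (edge_pairs EH A B) = (\<Sum>u\<in>A. card (nbhd EH u \<inter> B))"
  unfolding edge_pairs_def using assms by (intro card_SigmaI) auto

lemma card_edge_pairs_commute: "card (edge_pairs EH A B) = card (edge_pairs EH B A)"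
proof (rule bij_betw_same_card)
  show "bij_betw prod.swap (edge_pairs EH A B) (edge_pairs EH B A)"
    by (rule bij_betwI[where g = prod.swap]) (auto simp: edge_pairs_def nbhd_def insert_commute)
qed

lemma card_edge_pairs_diag:
  assumes S: "finite S" and EH: "\<And>e. e \<in> EH \<Longrightarrow> card e = 2"
  shows "card (edge_pairs EH S S) = 2 * card (edges_in EH S)"
proof -
  let ?e = "\<lambda>(u, v). {u, v}"
  have fin: "finite (edge_pairs EH S S)" "finite (edges_in EH S)"
    using S by (auto simp: edge_pairs_def edges_in_def intro: finite_subset[of _ "Pow S"])
  have "card (edge_pairs EH S S) = (\<Sum>e\<in>edges_in EH S. card {z \<in> edge_pairs EH S S. ?e z = e})"
    using sum.group[OF fin, of ?e "\<lambda>_. 1 :: nat"] by (force simp: edge_pairs_def nbhd_def edges_in_def)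
  also have "\<dots> = (\<Sum>e\<in>edges_in EH S. 2)"
  proof (rule sum.cong[OF refl])
    fix e assume e: "e \<in> edges_in EH S"
    then obtain a b where ab: "e = {a, b}" "a \<noteq> b"
      using EH[of e] unfolding edges_in_def by (auto simp: card_2_iff)
    then have "{z \<in> edge_pairs EH S S. ?e z = e} = {(a, b), (b, a)}"
      using e unfolding edges_in_def edge_pairs_def nbhd_def
      by (auto simp: doubleton_eq_iff insert_commute)
    then show "card {z \<in> edge_pairs EH S S. ?e z = e} = 2"
      using ab by simp
  qed
  finally show ?thesis by simp
qed

text \<open>A path $u, x, w$ with $u \notin F$ and $w \in F$ contains a pair crossing from the complement of
  $F$ to $F$, and is determined by that pair together with its remaining vertex.\<close>

lemma card_crossing_pairs_ge:
  assumes X: "finite X" "F \<subseteq> X" "\<And>v. nbhd EH v \<subseteq> X"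
    and codeg: "\<And>u w. u \<in> X - F \<Longrightarrow> w \<in> F \<Longrightarrow> \<gamma> * real (card X) \<le> real (card (nbhd EH u \<inter> nbhd EH w))"
  shows "\<gamma> * real (card (X - F)) * real (card F) \<le> real (card (edge_pairs EH (X - F) F))"
proof (cases "X = {}")
  case False
  let ?R = "X - F"
  define P where "P = (SIGMA (u, w):?R \<times> F. nbhd EH u \<inter> nbhd EH w)"
  have fin: "finite F" "finite ?R"
    using X finite_subset by auto
  have in_X: "x \<in> X" if "{v, x} \<in> EH" for v x
    using X(3)[of v] that unfolding nbhd_def by blast
  have "card P \<le> card (edge_pairs EH ?R F \<times> X)"
  proof (rule card_inj_on_le)
    let ?j = "\<lambda>((u, w), x). if x \<in> ?R then ((x, w), u) else ((u, x), w)"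
    show "inj_on ?j P"
      unfolding P_def inj_on_def by (auto split: if_splits)
    show "?j ` P \<subseteq> edge_pairs EH ?R F \<times> X"
      using X(2) in_X unfolding P_def edge_pairs_def nbhd_def
      by (auto simp: insert_commute split: if_splits)
    show "finite (edge_pairs EH ?R F \<times> X)"
      using X(1) fin unfolding edge_pairs_def by simp
  qed
  then have upper: "real (card P) \<le> real (card (edge_pairs EH ?R F)) * real (card X)"
    by (simp only: card_cartesian_product of_nat_mult[symmetric] of_nat_le_iff)
  have "card P = (\<Sum>(u, w)\<in>?R \<times> F. card (nbhd EH u \<inter> nbhd EH w))"
    unfolding P_def using fin finite_subset[OF X(3) X(1)]
    by (subst card_SigmaI) (auto simp: case_prod_beta)
  then have "real (card P) = (\<Sum>(u, w)\<in>?R \<times> F. real (card (nbhd EH u \<inter> nbhd EH w)))"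
    by (simp add: case_prod_beta)
  moreover have "(\<Sum>z\<in>?R \<times> F. \<gamma> * real (card X)) \<le> (\<Sum>(u, w)\<in>?R \<times> F. real (card (nbhd EH u \<inter> nbhd EH w)))"
    using codeg by (intro sum_mono) auto
  ultimately have "(\<gamma> * real (card ?R) * real (card F)) * real (card X)
      \<le> real (card (edge_pairs EH ?R F)) * real (card X)"
    using upper by (simp add: card_cartesian_product mult_ac)
  then show ?thesis
    using False X(1) by (simp add: card_gt_0_iff)
qed (use X in simp)

lemma sum_card_nbhd:
  assumes X: "finite X" and EH: "EH \<subseteq> {e. e \<subseteq> X \<and> card e = 2}"
  shows "(\<Sum>v\<in>X. card (nbhd EH v)) = 2 * card EH"
proof -
  have "nbhd EH v \<inter> X = nbhd EH v" for v
    using EH unfolding nbhd_def by blast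
  moreover have "edges_in EH X = EH"
    using EH unfolding edges_in_def by blast
  ultimately show ?thesis
    using card_edge_pairs[OF X X, of EH] card_edge_pairs_diag[OF X, of EH] EH by auto
qed

lemma card_edges_split:
  assumes X: "finite X" "F \<subseteq> X" and EH: "EH \<subseteq> {e. e \<subseteq> X \<and> card e = 2}"
  shows "2 * card EH =
    (\<Sum>v\<in>X - F. card (nbhd EH v)) + 2 * card (edges_in EH F) + card (edge_pairs EH (X - F) F)"
proof -
  have fin: "finite F" "finite (X - F)"
    using X finite_subset by auto
  have "card (nbhd EH v) = card (nbhd EH v \<inter> F) + card (nbhd EH v \<inter> (X - F))" for v
  proof -
    have "nbhd EH v = (nbhd EH v \<inter> F) \<union> (nbhd EH v \<inter> (X - F))"
      using EH unfolding nbhd_def by blast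
    then show ?thesis
      using fin card_Un_disjoint[of "nbhd EH v \<inter> F" "nbhd EH v \<inter> (X - F)"] by auto
  qed
  then have "(\<Sum>v\<in>F. card (nbhd EH v)) = card (edge_pairs EH F F) + card (edge_pairs EH F (X - F))"
    by (simp add: card_edge_pairs fin sum.distrib)
  also have "\<dots> = 2 * card (edges_in EH F) + card (edge_pairs EH (X - F) F)"
    using card_edge_pairs_diag[OF fin(1), of EH] card_edge_pairs_commute[of EH F "X - F"] EH by auto
  finally show ?thesis
    using sum_card_nbhd[OF X(1) EH] sum.subset_diff[OF X(2,1), of "\<lambda>v. card (nbhd EH v)"] by simp
qed

lemma card_edges_outside_ge:
  assumes X: "finite X" "F \<subseteq> X" and EH: "EH \<subseteq> {e. e \<subseteq> X \<and> card e = 2}"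
    and deg: "\<And>v. v \<in> X \<Longrightarrow> \<delta> \<le> real (card (nbhd EH v))"
    and codeg: "\<And>u w. u \<in> X \<Longrightarrow> w \<in> X \<Longrightarrow> u \<noteq> w \<Longrightarrow> \<gamma> * real (card X) \<le> real (card (nbhd EH u \<inter> nbhd EH w))"
  shows "real (card (X - F)) * (\<delta> + \<gamma> * real (card F))
    \<le> 2 * (real (card EH) - real (card (edges_in EH F)))"
proof -
  have "(\<Sum>v\<in>X - F. \<delta>) \<le> (\<Sum>v\<in>X - F. real (card (nbhd EH v)))"
    using deg by (intro sum_mono) auto
  moreover have "\<gamma> * real (card (X - F)) * real (card F) \<le> real (card (edge_pairs EH (X - F) F))"
  proof (intro card_crossing_pairs_ge X)
    show "nbhd EH v \<subseteq> X" for v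
      using EH unfolding nbhd_def by blast
  qed (use X(2) codeg in auto)
  moreover have "2 * real (card EH) = (\<Sum>v\<in>X - F. real (card (nbhd EH v)))
      + 2 * real (card (edges_in EH F)) + real (card (edge_pairs EH (X - F) F))"
    using arg_cong[OF card_edges_split[OF X EH], of real] by simp
  ultimately show ?thesis
    by (simp add: algebra_simps)
qed

lemma real_choose_two: "real (n choose 2) = real n * (real n - 1) / 2"
proof -
  have "2 * (n choose 2) = n * (n - 1)"
    unfolding choose_two by (rule dvd_mult_div_cancel) (cases "even n"; simp)
  then have "real (2 * (n choose 2)) = real (n * (n - 1))"
    by simp
  then show ?thesis
    by (cases n) (auto simp: algebra_simps)
qed

lemma card_edges_in_le_of_small:
  assumes EH: "EH \<subseteq> {e. card e = 2}" and F: "finite F" "2 \<le> card F" and l: "real (card F) + 1 \<le> 2 * l"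
  shows "real (card (edges_in EH F)) \<le> l * (real (card F) - 2) + 1"
proof -
  have "card (edges_in EH F) \<le> card {B. B \<subseteq> F \<and> card B = 2}"
    using EH F(1) by (intro card_mono) (auto simp: edges_in_def)
  then have "real (card (edges_in EH F)) \<le> real (card F choose 2)"
    by (simp add: n_subsets[OF F(1)])
  also have "\<dots> = (real (card F) + 1) / 2 * (real (card F) - 2) + 1"
    unfolding real_choose_two by (simp add: field_simps)
  also have "\<dots> \<le> l * (real (card F) - 2) + 1"
    using l F(2) by (intro add_right_mono mult_right_mono) auto
  finally show ?thesis .
qed

lemma balanced_graphI:
  assumes EH: "EH \<subseteq> all_edges k" and k: "3 \<le> k" and l: "l = lambda_H k EH" "1 \<le> l"
    and deg: "\<And>v. v < k \<Longrightarrow> \<delta> \<le> real (card (nbhd EH v))"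
    and codeg: "\<And>u w. u < k \<Longrightarrow> w < k \<Longrightarrow> u \<noteq> w \<Longrightarrow> \<gamma> * real k \<le> real (card (nbhd EH u \<inter> nbhd EH w))"
    and size: "\<And>s::real. s + 1 \<le> 2 * l \<or> 2 * l + 2 \<le> \<delta> + \<gamma> * s"
  shows "balanced_graph k EH"
proof (unfold_locales, fold l(1))
  fix F assume F: "F \<subset> {0..<k}" "2 \<le> card F"
  have finF: "finite F"
    using F finite_subset by auto
  show "real (card (edges_in EH F)) \<le> l * (real (card F) - 2) + 1"
    using size[of "real (card F)"]
  proof
    assume "real (card F) + 1 \<le> 2 * l"
    then show ?thesis
      using EH finF F(2) by (intro card_edges_in_le_of_small) (auto simp: all_edges_altdef)
  next
    assume large: "2 * l + 2 \<le> \<delta> + \<gamma> * real (card F)"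
    define r where "r = real (card ({0..<k} - F))"
    have "card F < k"
      using psubset_card_mono[OF _ F(1)] by simp
    then have r: "r = real k - real (card F)" "1 \<le> r"
      unfolding r_def using F finF by (auto simp: card_Diff_subset of_nat_diff)
    have "r * (2 * l + 2) \<le> r * (\<delta> + \<gamma> * real (card F))"
      using large r(2) by (intro mult_left_mono) auto
    also have "\<dots> \<le> 2 * (real (card EH) - real (card (edges_in EH F)))"
      unfolding r_def using F(1) EH deg codeg
      by (intro card_edges_outside_ge) (auto simp: all_edges_altdef)
    finally have "real (card (edges_in EH F)) \<le> real (card EH) - r * l - r"
      by (simp add: algebra_simps)
    also have "real (card EH) = l * (real (card F) + r - 2) + 2"
      using lambda_H_mult[OF k, of EH] r(1) unfolding l(1)[symmetric] by simp
    also have "l * (real (card F) + r - 2) + 2 - r * l - r \<le> l * (real (card F) - 2) + 1"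
      using r(2) by (simp add: algebra_simps)
    finally show ?thesis .
  qed
qed (use EH k l(2) in auto)

definition pseudo_random :: "real \<Rightarrow> real \<Rightarrow> nat \<Rightarrow> nat set set \<Rightarrow> bool" where
  "pseudo_random \<alpha> \<eta> k EH \<longleftrightarrow> EH \<subseteq> all_edges k \<and>
     (\<forall>v<k. \<bar>real (card (nbhd EH v)) - \<alpha> * (real k - 1)\<bar> < \<eta> * (real k - 1)) \<and>
     (\<forall>u<k. \<forall>w<k. u \<noteq> w \<longrightarrow>
        \<bar>real (card (nbhd EH u \<inter> nbhd EH w)) - \<alpha>\<^sup>2 * (real k - 2)\<bar> < \<eta> * (real k - 2))"

lemma lambda_H_degree_bounds:
  assumes EH: "EH \<subseteq> all_edges k" and k: "3 \<le> k"
    and deg: "\<And>v. v < k \<Longrightarrow> \<delta> \<le> real (card (nbhd EH v))" "\<And>v. v < k \<Longrightarrow> real (card (nbhd EH v)) \<le> \<Delta>"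
    and \<delta>: "2 \<le> \<delta>" and \<Delta>: "\<Delta> \<le> 2 * (real k - 1)"
  shows "\<delta> \<le> 2 * lambda_H k EH" "2 * lambda_H k EH \<le> \<Delta> + 4"
proof -
  have "(\<Sum>v<k. card (nbhd EH v)) = 2 * card EH"
    using sum_card_nbhd[of "{0..<k}" EH] EH by (simp add: all_edges_altdef lessThan_atLeast0)
  then have sum: "(\<Sum>v<k. real (card (nbhd EH v))) = 2 * real (card EH)"
    by (simp flip: of_nat_sum)
  have k2: "0 < real k - 2"
    using k by simp
  have "(\<Sum>v<k. \<delta>) \<le> 2 * real (card EH)" "2 * real (card EH) \<le> (\<Sum>v<k. \<Delta>)"
    unfolding sum[symmetric] using deg by (intro sum_mono; simp)+
  then have "\<delta> * (real k - 2) \<le> (2 * lambda_H k EH) * (real k - 2)"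
    "(2 * lambda_H k EH) * (real k - 2) \<le> (\<Delta> + 4) * (real k - 2)"
    using lambda_H_mult[OF k, of EH] \<delta> \<Delta> by (simp_all add: algebra_simps)
  then show "\<delta> \<le> 2 * lambda_H k EH" "2 * lambda_H k EH \<le> \<Delta> + 4"
    using k2 by simp_all
qed

lemma pseudo_randomD:
  assumes "pseudo_random \<alpha> \<eta> k EH"
  shows "EH \<subseteq> all_edges k"
    and "v < k \<Longrightarrow> (\<alpha> - \<eta>) * (real k - 1) \<le> real (card (nbhd EH v))"
    and "v < k \<Longrightarrow> real (card (nbhd EH v)) \<le> (\<alpha> + \<eta>) * (real k - 1)"
    and "u < k \<Longrightarrow> w < k \<Longrightarrow> u \<noteq> w \<Longrightarrow> (\<alpha>\<^sup>2 - \<eta>) * (real k - 2) \<le> real (card (nbhd EH u \<inter> nbhd EH w))"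
  using assms unfolding pseudo_random_def by (fastforce simp: abs_less_iff algebra_simps)+

lemma pseudo_random_lambda_bounds:
  assumes EH: "pseudo_random \<alpha> \<eta> k EH" and k: "3 \<le> k"
    and deg: "2 \<le> (\<alpha> - \<eta>) * (real k - 1)" "\<alpha> + \<eta> \<le> 2"
  shows "(\<alpha> - \<eta>) * (real k - 1) \<le> 2 * lambda_H k EH" "2 * lambda_H k EH \<le> (\<alpha> + \<eta>) * (real k - 1) + 4"
proof -
  have "(\<alpha> + \<eta>) * (real k - 1) \<le> 2 * (real k - 1)"
    using deg(2) k by (intro mult_right_mono) auto
  note bounds = lambda_H_degree_bounds[OF pseudo_randomD(1)[OF EH] k pseudo_randomD(2,3)[OF EH] deg(1) this]
  show "(\<alpha> - \<eta>) * (real k - 1) \<le> 2 * lambda_H k EH" "2 * lambda_H k EH \<le> (\<alpha> + \<eta>) * (real k - 1) + 4"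
    by (rule bounds; assumption)+
qed

lemma cubic_parameter_bounds:
  fixes \<alpha> \<eta> x :: real
  assumes \<alpha>: "0 < \<alpha>" "\<alpha> \<le> 1" and \<eta>: "\<eta> = \<alpha> ^ 3 / 32" and x: "4 / \<eta> \<le> x"
  shows "0 < \<eta>" "\<eta> \<le> \<alpha>\<^sup>2 / 32" "\<eta> \<le> \<alpha> / 32" "4 \<le> \<eta> * x" "\<eta> * x \<le> \<alpha> * x / 32" "128 \<le> x"
proof -
  have "\<alpha> ^ 3 \<le> \<alpha>\<^sup>2" "\<alpha>\<^sup>2 \<le> \<alpha>"
    using \<alpha> power_decreasing[of 2 3 \<alpha>] power_decreasing[of 1 2 \<alpha>] by simp_all
  then show \<eta>_bounds: "0 < \<eta>" "\<eta> \<le> \<alpha>\<^sup>2 / 32" "\<eta> \<le> \<alpha> / 32"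
    using \<alpha> unfolding \<eta> by auto
  have "0 < 4 / \<eta>"
    using \<eta>_bounds(1) by simp
  then have "0 < x"
    using x by linarith
  then show \<eta>x: "4 \<le> \<eta> * x" "\<eta> * x \<le> \<alpha> * x / 32"
    using x \<eta>_bounds(1) mult_right_mono[OF \<eta>_bounds(3), of x]
    by (simp_all add: pos_divide_le_eq mult.commute)
  have "\<alpha> * x \<le> x"
    using mult_right_mono[OF \<alpha>(2), of x] \<open>0 < x\<close> by simp
  then show "128 \<le> x"
    using \<eta>x by linarith
qed

text \<open>Sets of at least $\alpha k / 2$ vertices have to be handled by their codegrees: they contribute
  $(\alpha^2 / 4) (\alpha k / 2) = 4 \eta k$, which exceeds the deviation $2 \eta k$ of the degrees.\<close>

lemma pseudo_random_balanced:
  assumes \<alpha>: "0 < \<alpha>" "\<alpha> \<le> 1" and \<eta>: "\<eta> = \<alpha> ^ 3 / 32" and k: "4 / \<eta> \<le> real k"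
    and EH: "pseudo_random \<alpha> \<eta> k EH"
  shows "balanced_graph k EH"
proof -
  define \<delta> \<Delta> where "\<delta> = (\<alpha> - \<eta>) * (real k - 1)" and "\<Delta> = (\<alpha> + \<eta>) * (real k - 1)"
  note \<eta>_bounds = cubic_parameter_bounds(1-3)[OF \<alpha> \<eta> k]
    and \<eta>k = cubic_parameter_bounds(4,5)[OF \<alpha> \<eta> k] and k_ge = cubic_parameter_bounds(6)[OF \<alpha> \<eta> k]
  have k3: "3 \<le> k"
    using k_ge by simp
  have \<delta>_ge: "\<alpha> * real k / 2 + 3 \<le> \<delta>"
    unfolding \<delta>_def using \<eta>k \<alpha> \<eta>_bounds by (simp add: algebra_simps)
  then have "2 \<le> \<delta>"
    using \<eta>k by linarith
  then have l_bounds: "\<delta> \<le> 2 * lambda_H k EH" "2 * lambda_H k EH \<le> \<Delta> + 4"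
    using pseudo_random_lambda_bounds[OF EH k3] \<alpha> \<eta>_bounds unfolding \<delta>_def \<Delta>_def by auto
  have gap: "\<Delta> - \<delta> \<le> 2 * (\<eta> * real k)"
    unfolding \<delta>_def \<Delta>_def using \<eta>_bounds by (simp add: algebra_simps)
  show ?thesis
  proof (rule balanced_graphI[OF pseudo_randomD(1)[OF EH] k3 refl _ pseudo_randomD(2)[OF EH, folded \<delta>_def]])
    show "1 \<le> lambda_H k EH"
      using l_bounds(1) \<open>2 \<le> \<delta>\<close> by linarith
    show "\<alpha>\<^sup>2 / 4 * real k \<le> real (card (nbhd EH u \<inter> nbhd EH w))" if "u < k" "w < k" "u \<noteq> w" for u w
    proof -
      have "\<alpha>\<^sup>2 / 4 * real k \<le> \<alpha>\<^sup>2 / 2 * (real k - 2)"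
        using mult_left_mono[of 4 "real k" "\<alpha>\<^sup>2"] k_ge by (simp add: field_simps)
      also have "\<dots> \<le> (\<alpha>\<^sup>2 - \<eta>) * (real k - 2)"
        using k_ge \<eta>_bounds zero_le_power2[of \<alpha>] by (intro mult_right_mono) linarith+
      finally show ?thesis
        using pseudo_randomD(4)[OF EH that] by linarith
    qed
    show "s + 1 \<le> 2 * lambda_H k EH \<or> 2 * lambda_H k EH + 2 \<le> \<delta> + \<alpha>\<^sup>2 / 4 * s" for s
    proof (cases "s + 1 \<le> 2 * lambda_H k EH")
      case False
      then have "\<alpha> * real k / 2 \<le> s"
        using l_bounds(1) \<delta>_ge by linarith
      then have "\<alpha>\<^sup>2 / 4 * (\<alpha> * real k / 2) \<le> \<alpha>\<^sup>2 / 4 * s"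
        by (intro mult_left_mono) auto
      moreover have "\<alpha>\<^sup>2 / 4 * (\<alpha> * real k / 2) = 4 * (\<eta> * real k)"
        unfolding \<eta> by (simp add: power2_eq_square power3_eq_cube)
      ultimately show ?thesis
        using l_bounds(2) gap \<eta>k by linarith
    qed simp
  qed
qed

lemma prob_degree_deviation_le:
  assumes v: "v < k" and \<alpha>: "0 \<le> \<alpha>" "\<alpha> \<le> 1" and \<eta>: "0 \<le> \<eta>"
  shows "measure_pmf.prob (random_subset \<alpha> (all_edges k))
      {G. \<eta> * (real k - 1) \<le> \<bar>real (card (nbhd G v)) - \<alpha> * (real k - 1)\<bar>}
    \<le> 2 * exp (- 2 * \<eta>\<^sup>2 * (real k - 1))"
proof -
  let ?q = "random_subset \<alpha> (all_edges k)" and ?I = "{0..<k} - {v}"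
  have card_I: "real (card ?I) = real k - 1"
    using v by (simp add: of_nat_diff)
  have nbhd: "nbhd G v = {x \<in> ?I. {{v, x}} \<subseteq> G}" if "G \<in> set_pmf ?q" for G
    using that set_random_subset[of \<alpha> "all_edges k"] unfolding nbhd_def all_edges_altdef by fastforce
  have "measure_pmf.prob ?q {G. \<eta> * (real k - 1) \<le> \<bar>real (card (nbhd G v)) - \<alpha> * (real k - 1)\<bar>}
      \<le> measure_pmf.prob ?q
        {G. \<eta> * real (card ?I) \<le> \<bar>real (card {x \<in> ?I. {{v, x}} \<subseteq> G}) - \<alpha> ^ 1 * real (card ?I)\<bar>}"
    unfolding card_I by (intro measure_pmf.finite_measure_mono_AE AE_pmfI) (simp_all add: nbhd)
  also have "\<dots> \<le> 2 * exp (- 2 * \<eta>\<^sup>2 * real (card ?I))"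
  proof (rule prob_random_subset_card_deviation_le[OF _ _ _ _ _ \<alpha> \<eta>])
    show "{{v, x}} \<subseteq> all_edges k" if "x \<in> ?I" for x
      using that v unfolding all_edges_def by auto
    show "disjoint_family_on (\<lambda>x. {{v, x}}) ?I"
      unfolding disjoint_family_on_def by (auto simp: doubleton_eq_iff)
  qed auto
  finally show ?thesis
    unfolding card_I .
qed

lemma prob_codegree_deviation_le:
  assumes uw: "u < k" "w < k" "u \<noteq> w" and \<alpha>: "0 \<le> \<alpha>" "\<alpha> \<le> 1" and \<eta>: "0 \<le> \<eta>"
  shows "measure_pmf.prob (random_subset \<alpha> (all_edges k))
      {G. \<eta> * (real k - 2) \<le> \<bar>real (card (nbhd G u \<inter> nbhd G w)) - \<alpha>\<^sup>2 * (real k - 2)\<bar>}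
    \<le> 2 * exp (- 2 * \<eta>\<^sup>2 * (real k - 2))"
proof -
  let ?q = "random_subset \<alpha> (all_edges k)" and ?I = "{0..<k} - {u, w}"
  have card_I: "real (card ?I) = real k - 2"
    using uw by (simp add: of_nat_diff card_Diff_subset)
  have nbhd: "nbhd G u \<inter> nbhd G w = {x \<in> ?I. {{u, x}, {w, x}} \<subseteq> G}" if "G \<in> set_pmf ?q" for G
    using that set_random_subset[of \<alpha> "all_edges k"] unfolding nbhd_def all_edges_altdef by fastforce
  have "measure_pmf.prob ?q
        {G. \<eta> * (real k - 2) \<le> \<bar>real (card (nbhd G u \<inter> nbhd G w)) - \<alpha>\<^sup>2 * (real k - 2)\<bar>}
      \<le> measure_pmf.prob ?q
        {G. \<eta> * real (card ?I) \<le> \<bar>real (card {x \<in> ?I. {{u, x}, {w, x}} \<subseteq> G}) - \<alpha>\<^sup>2 * real (card ?I)\<bar>}"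
    unfolding card_I by (intro measure_pmf.finite_measure_mono_AE AE_pmfI) (simp_all add: nbhd)
  also have "\<dots> \<le> 2 * exp (- 2 * \<eta>\<^sup>2 * real (card ?I))"
  proof (rule prob_random_subset_card_deviation_le[OF _ _ _ _ _ \<alpha> \<eta>])
    show "{{u, x}, {w, x}} \<subseteq> all_edges k" if "x \<in> ?I" for x
      using that uw unfolding all_edges_def by auto
    show "disjoint_family_on (\<lambda>x. {{u, x}, {w, x}}) ?I"
      unfolding disjoint_family_on_def by (auto simp: doubleton_eq_iff)
    show "card {{u, x}, {w, x}} = 2" for x
      using uw by (auto simp: card_2_iff doubleton_eq_iff)
  qed auto
  finally show ?thesis
    unfolding card_I .
qed

lemma gnp_prob_pseudo_random_ge:
  assumes \<alpha>: "0 \<le> \<alpha>" "\<alpha> \<le> 1" and \<eta>: "0 \<le> \<eta>"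
  shows "1 - (real k * (2 * exp (- 2 * \<eta>\<^sup>2 * (real k - 1)))
      + real k ^ 2 * (2 * exp (- 2 * \<eta>\<^sup>2 * (real k - 2))))
    \<le> gnp_prob k \<alpha> (pseudo_random \<alpha> \<eta> k)"
proof -
  let ?q = "random_subset \<alpha> (all_edges k)" and ?W = "{(u, w). u < k \<and> w < k \<and> u \<noteq> w}"
  let ?deg = "\<lambda>v G. \<eta> * (real k - 1) \<le> \<bar>real (card (nbhd G v)) - \<alpha> * (real k - 1)\<bar>"
  let ?codeg = "\<lambda>(u, w) G. \<eta> * (real k - 2) \<le> \<bar>real (card (nbhd G u \<inter> nbhd G w)) - \<alpha>\<^sup>2 * (real k - 2)\<bar>"
  have W: "?W \<subseteq> {..<k} \<times> {..<k}"
    by auto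
  then have finW: "finite ?W"
    by (rule finite_subset) simp
  have "1 - measure_pmf.prob ?q {G. pseudo_random \<alpha> \<eta> k G}
      = measure_pmf.prob ?q {G. \<not> pseudo_random \<alpha> \<eta> k G}"
    using measure_pmf.prob_compl[of "{G. pseudo_random \<alpha> \<eta> k G}" ?q] by (simp add: set_diff_eq)
  also have "\<dots> \<le> measure_pmf.prob ?q ({G. \<exists>v\<in>{..<k}. ?deg v G} \<union> {G. \<exists>z\<in>?W. ?codeg z G})"
    using set_random_subset[of \<alpha> "all_edges k"]
    by (intro measure_pmf.finite_measure_mono_AE AE_pmfI) (auto simp: pseudo_random_def not_less)
  also have "\<dots> \<le> measure_pmf.prob ?q {G. \<exists>v\<in>{..<k}. ?deg v G}
      + measure_pmf.prob ?q {G. \<exists>z\<in>?W. ?codeg z G}"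
    by (intro measure_Un_le) auto
  also have "\<dots> \<le> (\<Sum>v<k. measure_pmf.prob ?q {G. ?deg v G})
      + (\<Sum>z\<in>?W. measure_pmf.prob ?q {G. ?codeg z G})"
    using finW by (intro add_mono measure_pmf_Ex_le_sum) auto
  also have "\<dots> \<le> (\<Sum>v<k. 2 * exp (- 2 * \<eta>\<^sup>2 * (real k - 1)))
      + (\<Sum>z\<in>?W. 2 * exp (- 2 * \<eta>\<^sup>2 * (real k - 2)))"
    using prob_degree_deviation_le[OF _ \<alpha> \<eta>] prob_codegree_deviation_le[OF _ _ _ \<alpha> \<eta>]
    by (intro add_mono sum_mono) auto
  also have "\<dots> \<le> real k * (2 * exp (- 2 * \<eta>\<^sup>2 * (real k - 1)))
      + real k ^ 2 * (2 * exp (- 2 * \<eta>\<^sup>2 * (real k - 2)))"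
  proof -
    have "card ?W \<le> k ^ 2"
      using card_mono[OF _ W] by (simp add: card_cartesian_product power2_eq_square)
    then have "real (card ?W) \<le> real k ^ 2"
      by (simp flip: of_nat_power)
    then show ?thesis
      by (simp add: mult_right_mono)
  qed
  finally show ?thesis
    using \<alpha> by (simp add: gnp_prob_eq_random_subset)
qed

lemma gnp_prob_tendsto_1I:
  assumes \<alpha>: "0 \<le> \<alpha>" "\<alpha> \<le> 1" and f: "f \<longlonglongrightarrow> 1" "\<forall>\<^sub>F k in sequentially. f k \<le> gnp_prob k \<alpha> (P k)"
  shows "(\<lambda>k. gnp_prob k \<alpha> (P k)) \<longlonglongrightarrow> 1"
proof (rule tendsto_sandwich[OF f(2) _ f(1) tendsto_const])
  show "\<forall>\<^sub>F k in sequentially. gnp_prob k \<alpha> (P k) \<le> 1"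
    using \<alpha> by (simp add: gnp_prob_eq_random_subset)
qed

lemma gnp_pseudo_random:
  assumes \<alpha>: "0 \<le> \<alpha>" "\<alpha> \<le> 1" and \<eta>: "0 < \<eta>"
  shows "(\<lambda>k. gnp_prob k \<alpha> (pseudo_random \<alpha> \<eta> k)) \<longlonglongrightarrow> 1"
proof (rule gnp_prob_tendsto_1I[OF \<alpha>])
  have "0 < \<eta>\<^sup>2"
    using \<eta> by simp
  then show "(\<lambda>k. 1 - (real k * (2 * exp (- 2 * \<eta>\<^sup>2 * (real k - 1)))
      + real k ^ 2 * (2 * exp (- 2 * \<eta>\<^sup>2 * (real k - 2))))) \<longlonglongrightarrow> 1"
    by real_asymp
qed (use gnp_prob_pseudo_random_ge[OF \<alpha>] \<eta> in auto)

lemma gnp_prob_mono: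
  assumes "0 \<le> p" "p \<le> 1" "\<And>G. P G \<Longrightarrow> Q G"
  shows "gnp_prob n p P \<le> gnp_prob n p Q"
  using assms by (auto simp: gnp_prob_eq_random_subset intro: measure_pmf.finite_measure_mono)

lemma gnp_balanced:
  assumes \<alpha>: "0 < \<alpha>" "\<alpha> \<le> 1"
  shows "(\<lambda>k. gnp_prob k \<alpha> (balanced_graph k)) \<longlonglongrightarrow> 1"
proof (rule gnp_prob_tendsto_1I)
  define \<eta> where "\<eta> = \<alpha> ^ 3 / 32"
  have "0 < \<eta>"
    unfolding \<eta>_def using \<alpha>(1) by simp
  then show "(\<lambda>k. gnp_prob k \<alpha> (pseudo_random \<alpha> \<eta> k)) \<longlonglongrightarrow> 1"
    using \<alpha> by (intro gnp_pseudo_random) auto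
  obtain N :: nat where N: "4 / \<eta> \<le> real N"
    using real_arch_simple by blast
  show "\<forall>\<^sub>F k in sequentially. gnp_prob k \<alpha> (pseudo_random \<alpha> \<eta> k) \<le> gnp_prob k \<alpha> (balanced_graph k)"
    using eventually_ge_at_top[of N]
  proof eventually_elim
    case (elim k)
    then have "4 / \<eta> \<le> real k"
      using N by linarith
    then show ?case
      using \<alpha> pseudo_random_balanced[OF \<alpha> \<eta>_def] by (intro gnp_prob_mono) auto
  qed
qed (use \<alpha> in auto)

theorem theorem1:
  fixes \<alpha> :: real
  assumes "0 < \<alpha>" and "\<alpha> \<le> 1"
  shows "(\<lambda>k. gnp_prob k \<alpha> (\<lambda>EH. \<exists>L.
            ((\<lambda>n. - ln (p_crit n k EH) / ln (real n)) \<longlonglongrightarrow> L) \<and>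
            L = 1 / lambda_H k EH)) \<longlonglongrightarrow> 1"
proof (rule gnp_prob_tendsto_1I)
  show "(\<lambda>k. gnp_prob k \<alpha> (balanced_graph k)) \<longlonglongrightarrow> 1"
    using assms by (rule gnp_balanced)
  show "\<forall>\<^sub>F k in sequentially. gnp_prob k \<alpha> (balanced_graph k) \<le> gnp_prob k \<alpha> (\<lambda>EH. \<exists>L.
      ((\<lambda>n. - ln (p_crit n k EH) / ln (real n)) \<longlonglongrightarrow> L) \<and> L = 1 / lambda_H k EH)"
    using assms
    by (intro always_eventually allI gnp_prob_mono) (auto dest: balanced_graph.p_crit_exponent)
qed (use assms in auto)

end
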